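(* Let $d\in\mathbb{N}$ and let $\mathcal{S}\subset\mathbb{Z}_+^d$ be a positive cone of $\mathbb{Z}^d$. Let $\iota^*:\overline{\mathbb{D}}^d\to\mathfrak{M}_{\mathcal{S}}$, $\iota^*(\zeta)=\mathrm{ev}_\zeta|_{\mathcal{A}(\mathcal{S})}$, be the continuous map induced by the embedding $\mathcal{A}(\mathcal{S})\hookrightarrow\mathcal{A}(\mathbb{Z}_+^d)$. Then the following are equivalent: (i) $\mathcal{S}_{\mathrm{sn}}=\mathbb{Z}_+^d$; (ii) the intersection of $\mathcal{S}$ with any axis is a non-trivial positive cone of $\mathbb{Z}$; that is, for every $i\in\{1,\dots,d\}$, the set $\{n\in\mathbb{Z}_+ \mid n\mathbf{i}\in\mathcal{S}\}$ is a non-trivial positive cone of $\mathbb{Z}$; (iii) $\iota^*$ is injective. In particular, $\iota^*$ is a homeomorphism when it is injective.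
   Context: $\mathbb{N}=\{1,2,\dots\}$, $\mathbb{Z}_+=\{0,1,2,\dots\}$, $\overline{\mathbb{D}}$ is the closed unit disc in $\mathbb{C}$, and $\mathbf{1},\dots,\mathbf{d}$ denote the standard generators of $\mathbb{Z}^d$ (so $\mathbf{i}$ is the $i$-th one). A positive cone $\mathcal{S}$ of an abelian group $\mathcal{G}$ is a unital sub-semigroup (i.e. containing $0$) of $\mathcal{G}$ such that (1) $\mathcal{S}\cap(-\mathcal{S})=\{0\}$, and (2) for every $g\in\mathcal{G}$ there are $s,t\in\mathcal{S}$ with $g=s-t$. Its seminormalization is $\mathcal{S}_{\mathrm{sn}}:=\{g\in\mathcal{G} \mid ng\in\mathcal{S} \text{ eventually for } n\in\mathbb{N}\}$, where "eventually" means for all sufficiently large $n$. The Fock representation $V:\mathcal{S}\to\mathcal{B}(\ell^2(\mathcal{S}))$ is given by $V_s e_t=e_{s+t}$, and $\mathcal{A}(\mathcal{S})$ is the norm-closed subalgebra of $\mathcal{B}(\ell^2(\mathcal{S}))$ generated by $\{V_s\mid s\in\mathcal{S}\}$. For a positive cone $\mathcal{S}\subset\mathbb{Z}_+^d$ of $\mathbb{Z}^d$, the assignment $V_s\mapsto V_s$ (from the Fock representation of $\mathcal{S}$ to that of $\mathbb{Z}_+^d$) extends to a completely isometric embedding $\mathcal{A}(\mathcal{S})\hookrightarrow\mathcal{A}(\mathbb{Z}_+^d)$, and $\mathcal{A}(\mathbb{Z}_+^d)$ is identified with the polydisc algebra $\mathbb{A}(\mathbb{D}^d)$ through $V_s\equiv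 z^s=z_1^{s_1}\cdots z_d^{s_d}$. $\mathfrak{M}_{\mathcal{S}}$ is the character space of $\mathcal{A}(\mathcal{S})$ (non-zero multiplicative linear functionals, with the weak* topology). The character space of $\mathcal{A}(\mathbb{Z}_+^d)$ is $\overline{\mathbb{D}}^d$, where $\zeta\in\overline{\mathbb{D}}^d$ corresponds to the point evaluation $\mathrm{ev}_\zeta$, determined by $\mathrm{ev}_\zeta(z^s)=\zeta^s=\zeta_1^{s_1}\cdots\zeta_d^{s_d}$ (with $0^0=1$). *)

theory Defs
  imports "HOL-Analysis.Analysis"
begin

definition positive_cone :: "'g::ab_group_add set \<Rightarrow> bool" where
  "positive_cone S \<longleftrightarrow>
     0 \<in> S \<and> (\<forall>s\<in>S. \<forall>t\<in>S. s + t \<in> S) \<and>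
     S \<inter> uminus ` S = {0} \<and>
     (\<forall>g. \<exists>s\<in>S. \<exists>t\<in>S. g = s - t)"

definition seminormalization :: "'g::ab_group_add set \<Rightarrow> 'g set" where
  "seminormalization S = {g. \<forall>\<^sub>F n in sequentially. (\<Sum>k<n. g) \<in> S}"

definition nonneg_orthant :: "(int ^ 'd) set" where
  "nonneg_orthant = {s. \<forall>i. 0 \<le> s $ i}"

definition axis_part :: "(int ^ 'd) set \<Rightarrow> 'd \<Rightarrow> int set" where
  "axis_part S i = {n. 0 \<le> n \<and> n *s axis i 1 \<in> S}"

text \<open>
  Since \<open>S\<close> is a set and not a type, vectors of \<open>\<ell>\<^sup>2(S)\<close> are functions on the ambient
  type that vanish off \<open>S\<close>, and operators are functions that are extensional
  on \<open>ell2 S\<close>, so that equality of operators is equality of functions.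
\<close>

definition ell2 :: "'a set \<Rightarrow> ('a \<Rightarrow> complex) set" where
  "ell2 S = {f. (\<forall>x. x \<notin> S \<longrightarrow> f x = 0) \<and> (\<lambda>x. (cmod (f x))\<^sup>2) summable_on S}"

definition ell2_norm :: "'a set \<Rightarrow> ('a \<Rightarrow> complex) \<Rightarrow> real" where
  "ell2_norm S f = sqrt (\<Sum>\<^sub>\<infinity>x\<in>S. (cmod (f x))\<^sup>2)"

definition ell2_basis :: "'a \<Rightarrow> 'a \<Rightarrow> complex" where
  "ell2_basis t = (\<lambda>x. if x = t then 1 else 0)"

type_synonym 'a operator = "('a \<Rightarrow> complex) \<Rightarrow> ('a \<Rightarrow> complex)"

definition bounded_operators :: "'a set \<Rightarrow> 'a operator set" where
  "bounded_operators S = {T \<in> ell2 S \<rightarrow>\<^sub>E ell2 S.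
     (\<forall>f\<in>ell2 S. \<forall>g\<in>ell2 S. T (\<lambda>x. f x + g x) = (\<lambda>x. T f x + T g x)) \<and>
     (\<forall>c. \<forall>f\<in>ell2 S. T (\<lambda>x. c * f x) = (\<lambda>x. c * T f x)) \<and>
     (\<exists>C. \<forall>f\<in>ell2 S. ell2_norm S (T f) \<le> C * ell2_norm S f)}"

definition op_norm :: "'a set \<Rightarrow> 'a operator \<Rightarrow> real" where
  "op_norm S T = Sup {ell2_norm S (T f) | f. f \<in> ell2 S \<and> ell2_norm S f \<le> 1}"

definition op_add :: "'a set \<Rightarrow> 'a operator \<Rightarrow> 'a operator \<Rightarrow> 'a operator" where
  "op_add S T U = (\<lambda>f\<in>ell2 S. \<lambda>x. T f x + U f x)"

definition op_scale :: "'a set \<Rightarrow> complex \<Rightarrow> 'a operator \<Rightarrow> 'a operator" where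
  "op_scale S c T = (\<lambda>f\<in>ell2 S. \<lambda>x. c * T f x)"

definition op_mult :: "'a set \<Rightarrow> 'a operator \<Rightarrow> 'a operator \<Rightarrow> 'a operator" where
  "op_mult S T U = compose (ell2 S) T U"

definition op_dist :: "'a set \<Rightarrow> 'a operator \<Rightarrow> 'a operator \<Rightarrow> real" where
  "op_dist S T U = op_norm S (op_add S T (op_scale S (-1) U))"

definition operator_subalgebra :: "'a set \<Rightarrow> 'a operator set \<Rightarrow> bool" where
  "operator_subalgebra S A \<longleftrightarrow>
     A \<subseteq> bounded_operators S \<and> A \<noteq> {} \<and>
     (\<forall>T\<in>A. \<forall>U\<in>A. op_add S T U \<in> A \<and> op_mult S T U \<in> A) \<and>
     (\<forall>c. \<forall>T\<in>A. op_scale S c T \<in> A)"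

definition norm_closed :: "'a set \<Rightarrow> 'a operator set \<Rightarrow> bool" where
  "norm_closed S A \<longleftrightarrow>
     (\<forall>T\<in>bounded_operators S. (\<forall>e>0. \<exists>U\<in>A. op_dist S T U < e) \<longrightarrow> T \<in> A)"

text \<open>
  For \<open>s \<in> S\<close> the formula below is the isometry \<open>e\<^sub>t \<mapsto> e\<^sub>s\<^sub>+\<^sub>t\<close>: the vector \<open>f\<close> vanishes off \<open>S\<close>,
  so \<open>f (u - s)\<close> is nonzero only for \<open>u \<in> s + S\<close>.
\<close>

definition fock :: "'g::ab_group_add set \<Rightarrow> 'g \<Rightarrow> 'g operator" where
  "fock S s = (\<lambda>f\<in>ell2 S. \<lambda>u. f (u - s))"

lemma ell2_basis_in_ell2: "t \<in> S \<Longrightarrow> ell2_basis t \<in> ell2 S"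
proof -
  assume t: "t \<in> S"
  have "(\<lambda>x. (cmod (ell2_basis t x))\<^sup>2) summable_on {t}"
    by simp
  then have "(\<lambda>x. (cmod (ell2_basis t x))\<^sup>2) summable_on S"
    by (rule summable_on_cong_neutral[THEN iffD1, rotated -1]) (use t in \<open>auto simp: ell2_basis_def\<close>)
  with t show ?thesis
    by (auto simp: ell2_def ell2_basis_def)
qed

lemma fock_basis: "t \<in> S \<Longrightarrow> fock S s (ell2_basis t) = ell2_basis (s + t)"
  using ell2_basis_in_ell2[of t S]
  by (simp add: fock_def) (auto simp: ell2_basis_def fun_eq_iff algebra_simps)

definition fock_algebra :: "'g::ab_group_add set \<Rightarrow> 'g operator set" where
  "fock_algebra S =
     \<Inter>{A. operator_subalgebra S A \<and> norm_closed S A \<and> fock S ` S \<subseteq> A}"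

definition character_space :: "'g::ab_group_add set \<Rightarrow> ('g operator \<Rightarrow> complex) set" where
  "character_space S = {\<phi> \<in> extensional (fock_algebra S).
     (\<exists>T\<in>fock_algebra S. \<phi> T \<noteq> 0) \<and>
     (\<forall>T\<in>fock_algebra S. \<forall>U\<in>fock_algebra S. \<phi> (op_add S T U) = \<phi> T + \<phi> U) \<and>
     (\<forall>c. \<forall>T\<in>fock_algebra S. \<phi> (op_scale S c T) = c * \<phi> T) \<and>
     (\<forall>T\<in>fock_algebra S. \<forall>U\<in>fock_algebra S. \<phi> (op_mult S T U) = \<phi> T * \<phi> U)}"

text \<open>The weak* topology is the topology of pointwise convergence on the algebra.\<close>

definition character_topology :: "'g::ab_group_add set \<Rightarrow> ('g operator \<Rightarrow> complex) topology" where
  "character_topology S =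
     subtopology (product_topology (\<lambda>_. euclidean) (fock_algebra S)) (character_space S)"

text \<open>
  An isometric homomorphism is determined by its values on the generators, so complete
  isometry of the embedding, which is automatic here, is not needed to single it out.
\<close>

definition fock_embedding :: "'g::ab_group_add set \<Rightarrow> 'g set \<Rightarrow> 'g operator \<Rightarrow> 'g operator" where
  "fock_embedding S P = (THE \<iota>. \<iota> \<in> fock_algebra S \<rightarrow>\<^sub>E fock_algebra P \<and>
     (\<forall>T\<in>fock_algebra S. \<forall>U\<in>fock_algebra S. \<iota> (op_add S T U) = op_add P (\<iota> T) (\<iota> U)) \<and>
     (\<forall>c. \<forall>T\<in>fock_algebra S. \<iota> (op_scale S c T) = op_scale P c (\<iota> T)) \<and>
     (\<forall>T\<in>fock_algebra S. \<forall>U\<in>fock_algebra S. \<iota> (op_mult S T U) = op_mult P (\<iota> T) (\<iota> U)) \<and>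
     (\<forall>T\<in>fock_algebra S. op_norm P (\<iota> T) = op_norm S T) \<and>
     (\<forall>s\<in>S. \<iota> (fock S s) = fock P s))"

definition closed_polydisc :: "(complex ^ 'd) set" where
  "closed_polydisc = {\<zeta>. \<forall>i. cmod (\<zeta> $ i) \<le> 1}"

definition monomial_value :: "complex ^ 'd \<Rightarrow> int ^ 'd \<Rightarrow> complex" where
  "monomial_value \<zeta> s = (\<Prod>i\<in>UNIV. (\<zeta> $ i) ^ nat (s $ i))"

text \<open>
  Under the identification of \<open>V\<^sub>s\<close> with the monomial \<open>z\<^sup>s\<close>, evaluation at \<open>\<zeta>\<close> is the
  character of the Fock algebra of the orthant with value \<open>\<zeta>\<^sup>s\<close> at \<open>V\<^sub>s\<close>.
\<close>

definition point_evaluation :: "complex ^ 'd \<Rightarrow> (int ^ 'd) operator \<Rightarrow> complex" where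
  "point_evaluation \<zeta> = (THE \<phi>. \<phi> \<in> character_space nonneg_orthant \<and>
     (\<forall>s\<in>nonneg_orthant. \<phi> (fock nonneg_orthant s) = monomial_value \<zeta> s))"

definition iota_star :: "(int ^ 'd) set \<Rightarrow> complex ^ 'd \<Rightarrow> (int ^ 'd) operator \<Rightarrow> complex" where
  "iota_star S \<zeta> =
     (\<lambda>T\<in>fock_algebra S. point_evaluation \<zeta> (fock_embedding S nonneg_orthant T))"

end

theory Submission
  imports Defs
begin

text \<open>
  A list of coefficients and exponents in \<open>S\<close> stands for a polynomial \<open>p = \<Sum> c z\<^sup>s\<close>, and the Fock
  algebra is the norm closure of the operators \<open>p(V)\<close> (\<open>fock_algebra_eq_shift_algebra\<close>).
  Two norm estimates for polynomials carry the analysis. First, \<open>p(V)\<close> has the same norm on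
  \<open>\<ell>\<^sup>2(S)\<close> as on \<open>\<ell>\<^sup>2\<close> of the orthant: vectors may be tested on finitely many coordinates, and since
  every element of the orthant is a difference of elements of \<open>S\<close>, a single shift moves these
  coordinates into \<open>S\<close> (\<open>op_norm_fock_comb_eq\<close>). Hence restricting operators to \<open>\<ell>\<^sup>2(S)\<close> is
  isometric, and the embedding of Fock algebras is its inverse. Second, \<open>|p(\<zeta>)|\<close> is at most the norm
  of \<open>p(V)\<close> for \<open>\<zeta>\<close> in the closed polydisc: for \<open>\<zeta>\<close> in the open polydisc the conjugated monomials
  at \<open>\<zeta>\<close> form a square-summable eigenvector of the adjoint shifts, and the boundary follows
  by a limit (\<open>polydisc_evaluation_bound\<close>). So evaluation at \<open>\<zeta>\<close> extends to a character, and
  \<open>\<iota>\<^sup>*\<close> is continuous because each \<open>\<zeta> \<mapsto> \<iota>\<^sup>*(\<zeta>)(T)\<close> is a uniform limit of polynomials.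

  Characters are contractive, by the usual Banach algebra argument (\<open>character_contractive\<close>);
  therefore a character \<open>\<phi>\<close> is determined by the multiplicative function \<open>s \<mapsto> \<phi>(V\<^sub>s)\<close> on \<open>S\<close>, and
  this function takes values in the closed unit disc. What remains concerns these functions only.

  The seminormalization condition and the axis condition both say that for each \<open>i\<close> all large
  multiples of the generator \<open>e\<^sub>i\<close> lie in \<open>S\<close>; for a submonoid of the nonnegative integers this
  amounts to generating the group of integers. If it holds, \<open>\<zeta>\<^sub>i\<close> is recovered from two consecutive
  powers, so \<open>\<iota>\<^sup>*\<close> is injective; moreover the multiplicative function of a character is
  \<open>n \<mapsto> \<zeta>\<^sub>i\<^sup>n\<close> along the far part of the \<open>i\<close>-th axis, and comparing two consecutive large powers
  shows that it is the monomial function of \<open>\<zeta>\<close> on all of \<open>S\<close>. Thus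
  \<open>\<iota>\<^sup>*\<close> is onto, and a continuous bijection from a compact to a Hausdorff space is a homeomorphism.
  If it fails at \<open>i\<close>, the \<open>i\<close>-th axis part lies in the multiples of some \<open>k \<ge> 2\<close>, and \<open>e\<^sub>i\<close> and \<open>\<omega> e\<^sub>i\<close>
  with \<open>\<omega>\<^sup>k = 1\<close> and \<open>\<omega> \<noteq> 1\<close> give the same character.
\<close>

section \<open>The Hilbert space of square-summable functions\<close>

lemma ell2_L2_set_le:
  assumes f: "f \<in> ell2 S" and F: "finite F"
  shows "L2_set (\<lambda>x. cmod (f x)) F \<le> ell2_norm S f"
proof -
  have "(\<Sum>x\<in>F. (cmod (f x))\<^sup>2) = (\<Sum>x\<in>F \<inter> S. (cmod (f x))\<^sup>2)"
    using f F by (intro sum.mono_neutral_right) (auto simp: ell2_def)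
  also have "\<dots> \<le> (\<Sum>\<^sub>\<infinity>x\<in>S. (cmod (f x))\<^sup>2)"
    using f F by (intro finite_sum_le_infsum) (auto simp: ell2_def)
  finally show ?thesis
    by (simp add: L2_set_def ell2_norm_def)
qed

text \<open>Boundedness of the finite partial sums is the working form of membership in \<open>\<ell>\<^sup>2(S)\<close>: it reduces
  each norm estimate below to one for finite sums and passes to pointwise limits.\<close>

lemma ell2_intro:
  assumes "\<And>x. x \<notin> S \<Longrightarrow> f x = 0"
    and bound: "\<And>F. finite F \<Longrightarrow> F \<subseteq> S \<Longrightarrow> L2_set (\<lambda>x. cmod (f x)) F \<le> C"
  shows ell2_memI: "f \<in> ell2 S" and ell2_norm_leI: "ell2_norm S f \<le> C"
proof -
  have C: "0 \<le> C" using bound[of "{}"] by simp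
  have *: "(\<Sum>x\<in>F. (cmod (f x))\<^sup>2) \<le> C\<^sup>2" if "finite F" "F \<subseteq> S" for F
    using bound[OF that] unfolding L2_set_def by (rule sqrt_le_D)
  have sm: "(\<lambda>x. (cmod (f x))\<^sup>2) summable_on S"
    by (rule nonneg_bdd_above_summable_on) (auto intro!: bdd_aboveI[where M = "C\<^sup>2"] *)
  with assms(1) show "f \<in> ell2 S" by (simp add: ell2_def)
  have "(\<Sum>\<^sub>\<infinity>x\<in>S. (cmod (f x))\<^sup>2) \<le> C\<^sup>2"
    by (rule infsum_le_finite_sums[OF sm *])
  then show "ell2_norm S f \<le> C"
    unfolding ell2_norm_def using C by (simp add: real_le_lsqrt infsum_nonneg)
qed

lemma ell2_outside: "f \<in> ell2 S \<Longrightarrow> x \<notin> S \<Longrightarrow> f x = 0"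
  by (simp add: ell2_def)

lemma ell2_norm_nonneg: "0 \<le> ell2_norm S f"
  by (simp add: ell2_norm_def infsum_nonneg)

lemma ell2_pointwise_le: "f \<in> ell2 S \<Longrightarrow> cmod (f x) \<le> ell2_norm S f"
  using ell2_L2_set_le[of f S "{x}"] by simp

lemma ell2_add:
  assumes "f \<in> ell2 S" "g \<in> ell2 S"
  shows ell2_add_mem: "(\<lambda>x. f x + g x) \<in> ell2 S"
    and ell2_norm_triangle: "ell2_norm S (\<lambda>x. f x + g x) \<le> ell2_norm S f + ell2_norm S g"
proof -
  have *: "L2_set (\<lambda>x. cmod (f x + g x)) F \<le> ell2_norm S f + ell2_norm S g" if "finite F" for F
  proof -
    have "L2_set (\<lambda>x. cmod (f x + g x)) F \<le> L2_set (\<lambda>x. cmod (f x) + cmod (g x)) F"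
      by (intro L2_set_mono norm_triangle_ineq) auto
    also have "\<dots> \<le> L2_set (\<lambda>x. cmod (f x)) F + L2_set (\<lambda>x. cmod (g x)) F"
      by (rule L2_set_triangle_ineq)
    finally show ?thesis
      using ell2_L2_set_le[OF assms(1) that] ell2_L2_set_le[OF assms(2) that] by simp
  qed
  show "(\<lambda>x. f x + g x) \<in> ell2 S"
    by (rule ell2_memI[OF _ *]) (use assms in \<open>auto simp: ell2_outside\<close>)
  show "ell2_norm S (\<lambda>x. f x + g x) \<le> ell2_norm S f + ell2_norm S g"
    by (rule ell2_norm_leI[OF _ *]) (use assms in \<open>auto simp: ell2_outside\<close>)
qed

lemma ell2_scale_mem: "f \<in> ell2 S \<Longrightarrow> (\<lambda>x. c * f x) \<in> ell2 S"
  by (auto simp: ell2_def norm_mult power_mult_distrib intro: summable_on_cmult_right)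

lemma ell2_norm_scale: "ell2_norm S (\<lambda>x. c * f x) = cmod c * ell2_norm S f"
  by (simp add: ell2_norm_def norm_mult power_mult_distrib infsum_cmult_right' real_sqrt_mult)

lemma ell2_diff_mem:
  assumes "f \<in> ell2 S" "g \<in> ell2 S"
  shows "(\<lambda>x. f x - g x) \<in> ell2 S"
  using ell2_add_mem[OF assms(1) ell2_scale_mem[OF assms(2), of "-1"]] by simp

lemma ell2_norm_diff_triangle:
  assumes "f \<in> ell2 S" "g \<in> ell2 S" "h \<in> ell2 S"
  shows "ell2_norm S (\<lambda>x. f x - h x) \<le> ell2_norm S (\<lambda>x. f x - g x) + ell2_norm S (\<lambda>x. g x - h x)"
  using ell2_norm_triangle[OF ell2_diff_mem[OF assms(1,2)] ell2_diff_mem[OF assms(2,3)]] by simp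

lemma ell2_norm_diff_commute: "ell2_norm S (\<lambda>x. f x - g x) = ell2_norm S (\<lambda>x. g x - f x)"
  by (simp add: ell2_norm_def norm_minus_commute)

lemma ell2_zero_mem: "(\<lambda>x. 0) \<in> ell2 S"
  by (simp add: ell2_def)

lemma ell2_norm_zero: "ell2_norm S (\<lambda>x. 0) = 0"
  by (simp add: ell2_norm_def)

text \<open>The index sets of source and target may differ; this is what moves vectors of the larger
  space into the smaller one in \<open>op_norm_fock_comb_eq\<close>.\<close>

lemma ell2_shift:
  fixes f :: "'g::ab_group_add \<Rightarrow> complex"
  assumes f: "f \<in> ell2 S" and supp: "\<And>t. f t \<noteq> 0 \<Longrightarrow> s + t \<in> P"
  shows ell2_shift_mem: "(\<lambda>u. f (u - s)) \<in> ell2 P"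
    and ell2_norm_shift_le: "ell2_norm P (\<lambda>u. f (u - s)) \<le> ell2_norm S f"
proof -
  have *: "L2_set (\<lambda>u. cmod (f (u - s))) F \<le> ell2_norm S f" if "finite F" for F
  proof -
    have "L2_set (\<lambda>u. cmod (f (u - s))) F = L2_set (\<lambda>u. cmod (f u)) ((\<lambda>u. u - s) ` F)"
      by (simp add: L2_set_def sum.reindex inj_on_def)
    then show ?thesis using ell2_L2_set_le[OF f, of "(\<lambda>u. u - s) ` F"] that by simp
  qed
  have **: "f (u - s) = 0" if "u \<notin> P" for u
    using supp[of "u - s"] that by auto
  show "(\<lambda>u. f (u - s)) \<in> ell2 P" by (rule ell2_memI[OF ** *])
  show "ell2_norm P (\<lambda>u. f (u - s)) \<le> ell2_norm S f" by (rule ell2_norm_leI[OF ** *])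
qed

section \<open>The Banach algebra of bounded operators\<close>

lemma bounded_operators_mem: "T \<in> bounded_operators S \<Longrightarrow> f \<in> ell2 S \<Longrightarrow> T f \<in> ell2 S"
  by (auto simp: bounded_operators_def)

lemma bounded_operators_add:
  "T \<in> bounded_operators S \<Longrightarrow> f \<in> ell2 S \<Longrightarrow> g \<in> ell2 S \<Longrightarrow> T (\<lambda>x. f x + g x) = (\<lambda>x. T f x + T g x)"
  by (auto simp: bounded_operators_def)

lemma bounded_operators_scale:
  "T \<in> bounded_operators S \<Longrightarrow> f \<in> ell2 S \<Longrightarrow> T (\<lambda>x. c * f x) = (\<lambda>x. c * T f x)"
  by (auto simp: bounded_operators_def)

lemma bounded_operators_diff:
  assumes "T \<in> bounded_operators S" "f \<in> ell2 S" "g \<in> ell2 S"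
  shows "T (\<lambda>x. f x - g x) = (\<lambda>x. T f x - T g x)"
  using bounded_operators_add[OF assms(1,2) ell2_scale_mem[OF assms(3), of "-1"]]
    bounded_operators_scale[OF assms(1,3), of "-1"] by simp

lemma bounded_operators_extensional: "T \<in> bounded_operators S \<Longrightarrow> T \<in> extensional (ell2 S)"
  by (auto simp: bounded_operators_def PiE_def)

lemma bounded_operators_eqI:
  assumes "T \<in> bounded_operators S" "U \<in> bounded_operators S"
    and "\<And>f x. f \<in> ell2 S \<Longrightarrow> x \<in> S \<Longrightarrow> T f x = U f x"
  shows "T = U"
proof (rule extensionalityI[OF bounded_operators_extensional bounded_operators_extensional])
  fix f assume f: "f \<in> ell2 S"
  show "T f = U f"
  proof
    fix x show "T f x = U f x"
      using assms(3)[OF f, of x] ell2_outside[OF bounded_operators_mem[OF assms(1) f]]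
        ell2_outside[OF bounded_operators_mem[OF assms(2) f]] by (cases "x \<in> S") auto
  qed
qed (use assms in auto)

lemma bounded_operatorsI:
  assumes "T \<in> extensional (ell2 S)" "\<And>f. f \<in> ell2 S \<Longrightarrow> T f \<in> ell2 S"
    "\<And>f g. f \<in> ell2 S \<Longrightarrow> g \<in> ell2 S \<Longrightarrow> T (\<lambda>x. f x + g x) = (\<lambda>x. T f x + T g x)"
    "\<And>c f. f \<in> ell2 S \<Longrightarrow> T (\<lambda>x. c * f x) = (\<lambda>x. c * T f x)"
    "\<And>f. f \<in> ell2 S \<Longrightarrow> ell2_norm S (T f) \<le> C * ell2_norm S f"
  shows "T \<in> bounded_operators S"
  using assms unfolding bounded_operators_def PiE_def Pi_def by blast

lemma ell2_norm_apply_le: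
  assumes T: "T \<in> bounded_operators S" and f: "f \<in> ell2 S"
  shows "ell2_norm S (T f) \<le> op_norm S T * ell2_norm S f"
proof -
  obtain C where C: "\<And>f. f \<in> ell2 S \<Longrightarrow> ell2_norm S (T f) \<le> C * ell2_norm S f"
    using T unfolding bounded_operators_def by blast
  show ?thesis
  proof (cases "ell2_norm S f = 0")
    case True
    then show ?thesis using C[OF f] by simp
  next
    case False
    define r where "r = ell2_norm S f"
    have r: "r > 0" using False ell2_norm_nonneg[of S f] by (simp add: r_def)
    define g where "g = (\<lambda>x. complex_of_real (1/r) * f x)"
    have g: "g \<in> ell2 S" "ell2_norm S g = 1"
      using f r by (simp_all only: g_def ell2_scale_mem ell2_norm_scale) (simp add: norm_divide r_def)
    have "ell2_norm S (T g) \<le> op_norm S T"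
      unfolding op_norm_def
    proof (rule cSup_upper)
      show "bdd_above {ell2_norm S (T f) |f. f \<in> ell2 S \<and> ell2_norm S f \<le> 1}"
      proof (rule bdd_aboveI[of _ "\<bar>C\<bar>"], clarify)
        fix f assume f: "f \<in> ell2 S" "ell2_norm S f \<le> 1"
        have "C * ell2_norm S f \<le> \<bar>C\<bar> * 1"
          by (intro mult_mono) (use f ell2_norm_nonneg[of S f] in auto)
        with C[OF f(1)] show "ell2_norm S (T f) \<le> \<bar>C\<bar>" by simp
      qed
    qed (use g in auto)
    moreover have "ell2_norm S (T g) = ell2_norm S (T f) / r"
      unfolding g_def bounded_operators_scale[OF T f] ell2_norm_scale
      using r by (simp add: norm_divide)
    ultimately show ?thesis
      using r by (simp add: field_simps r_def)
  qed
qed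

lemma op_norm_least:
  assumes C: "0 \<le> C" and "\<And>f. f \<in> ell2 S \<Longrightarrow> ell2_norm S (T f) \<le> C * ell2_norm S f"
  shows "op_norm S T \<le> C"
  unfolding op_norm_def
proof (rule cSup_least)
  show "{ell2_norm S (T f) |f. f \<in> ell2 S \<and> ell2_norm S f \<le> 1} \<noteq> {}"
    using ell2_zero_mem[of S] ell2_norm_zero[of S] by (auto intro!: exI[of _ "\<lambda>x. 0"])
next
  fix y assume "y \<in> {ell2_norm S (T f) |f. f \<in> ell2 S \<and> ell2_norm S f \<le> 1}"
  then obtain f where f: "f \<in> ell2 S" "ell2_norm S f \<le> 1" "y = ell2_norm S (T f)" by blast
  have "C * ell2_norm S f \<le> C * 1" using C f by (intro mult_left_mono) auto
  with assms(2)[OF f(1)] f show "y \<le> C" by simp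
qed

lemma op_norm_nonneg:
  assumes "T \<in> bounded_operators S"
  shows "0 \<le> op_norm S T"
proof (cases "\<exists>f\<in>ell2 S. ell2_norm S f \<noteq> 0")
  case True
  then obtain f where f: "f \<in> ell2 S" "ell2_norm S f > 0"
    using ell2_norm_nonneg[of S] by (metis less_eq_real_def)
  have "0 \<le> op_norm S T * ell2_norm S f"
    using ell2_norm_apply_le[OF assms f(1)] ell2_norm_nonneg[of S "T f"] by linarith
  with f(2) show ?thesis by (simp add: zero_le_mult_iff)
next
  case False
  then have "ell2_norm S (T f) = 0" if "f \<in> ell2 S" for f
    using bounded_operators_mem[OF assms that] by blast
  then have "{ell2_norm S (T f) |f. f \<in> ell2 S \<and> ell2_norm S f \<le> 1} = {0}"
    using ell2_zero_mem[of S] ell2_norm_zero[of S] by (auto intro!: exI[of _ "\<lambda>x. 0"])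
  then show ?thesis by (simp add: op_norm_def)
qed

lemma op_add_bounded:
  assumes "T \<in> bounded_operators S" "U \<in> bounded_operators S"
  shows "op_add S T U \<in> bounded_operators S"
proof (rule bounded_operatorsI[where C = "op_norm S T + op_norm S U"])
  fix f assume f: "f \<in> ell2 S"
  note * = assms[THEN bounded_operators_mem, OF f]
  show "op_add S T U f \<in> ell2 S"
    using f * by (simp add: op_add_def ell2_add_mem)
  have "ell2_norm S (op_add S T U f) \<le> ell2_norm S (T f) + ell2_norm S (U f)"
    using f * by (simp add: op_add_def ell2_norm_triangle)
  then show "ell2_norm S (op_add S T U f) \<le> (op_norm S T + op_norm S U) * ell2_norm S f"
    using assms[THEN ell2_norm_apply_le, OF f] by (simp add: algebra_simps)
qed (auto simp: op_add_def ell2_add_mem ell2_scale_mem bounded_operators_add[OF assms(1)]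
  bounded_operators_add[OF assms(2)] bounded_operators_scale[OF assms(1)]
  bounded_operators_scale[OF assms(2)] algebra_simps)

lemma op_scale_bounded:
  assumes "T \<in> bounded_operators S"
  shows "op_scale S c T \<in> bounded_operators S"
proof (rule bounded_operatorsI[where C = "cmod c * op_norm S T"])
  fix f assume f: "f \<in> ell2 S"
  note * = assms[THEN bounded_operators_mem, OF f]
  show "op_scale S c T f \<in> ell2 S"
    using f * by (simp add: op_scale_def ell2_scale_mem)
  show "ell2_norm S (op_scale S c T f) \<le> (cmod c * op_norm S T) * ell2_norm S f"
    using f assms[THEN ell2_norm_apply_le, OF f] 
    by (simp add: op_scale_def ell2_norm_scale mult.assoc mult_left_mono)
qed (auto simp: op_scale_def ell2_add_mem ell2_scale_mem bounded_operators_add[OF assms(1)]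
  bounded_operators_scale[OF assms(1)] algebra_simps)

lemma op_mult_bounded:
  assumes "T \<in> bounded_operators S" "U \<in> bounded_operators S"
  shows "op_mult S T U \<in> bounded_operators S"
proof (rule bounded_operatorsI[where C = "op_norm S T * op_norm S U"])
  fix f assume f: "f \<in> ell2 S"
  note * = assms(2)[THEN bounded_operators_mem, OF f]
  show "op_mult S T U f \<in> ell2 S"
    using f bounded_operators_mem[OF assms(1) *] by (simp add: op_mult_def compose_eq)
  have "ell2_norm S (op_mult S T U f) \<le> op_norm S T * ell2_norm S (U f)"
    using f ell2_norm_apply_le[OF assms(1) *] by (simp add: op_mult_def compose_eq)
  also have "\<dots> \<le> op_norm S T * (op_norm S U * ell2_norm S f)"
    by (intro mult_left_mono ell2_norm_apply_le assms f op_norm_nonneg)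
  finally show "ell2_norm S (op_mult S T U f) \<le> (op_norm S T * op_norm S U) * ell2_norm S f"
    by (simp add: mult.assoc)
qed (auto simp: op_mult_def compose_eq ell2_add_mem ell2_scale_mem
  bounded_operators_add[OF assms(1)] bounded_operators_scale[OF assms(1)]
  bounded_operators_add[OF assms(2)] bounded_operators_scale[OF assms(2)]
  bounded_operators_mem[OF assms(2)] compose_def)

lemma op_add_apply: "f \<in> ell2 S \<Longrightarrow> op_add S T U f = (\<lambda>x. T f x + U f x)"
  by (simp add: op_add_def)

lemma op_scale_apply: "f \<in> ell2 S \<Longrightarrow> op_scale S c T f = (\<lambda>x. c * T f x)"
  by (simp add: op_scale_def)

lemma op_mult_apply: "f \<in> ell2 S \<Longrightarrow> op_mult S T U f = T (U f)"
  by (simp add: op_mult_def compose_eq)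

lemma ell2_norm_diff_apply_le:
  assumes "T \<in> bounded_operators S" "U \<in> bounded_operators S" "f \<in> ell2 S"
  shows "ell2_norm S (\<lambda>x. T f x - U f x) \<le> op_dist S T U * ell2_norm S f"
  using ell2_norm_apply_le[OF op_add_bounded[OF assms(1) op_scale_bounded[OF assms(2), of "-1"]] assms(3)]
  by (simp add: op_dist_def op_add_apply op_scale_apply assms(3))

lemma op_dist_least:
  assumes "0 \<le> C" "\<And>f. f \<in> ell2 S \<Longrightarrow> ell2_norm S (\<lambda>x. T f x - U f x) \<le> C * ell2_norm S f"
  shows "op_dist S T U \<le> C"
  unfolding op_dist_def
  by (rule op_norm_least) (use assms in \<open>auto simp: op_add_apply op_scale_apply\<close>)

lemma op_dist_nonneg:
  "T \<in> bounded_operators S \<Longrightarrow> U \<in> bounded_operators S \<Longrightarrow> 0 \<le> op_dist S T U"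
  unfolding op_dist_def by (intro op_norm_nonneg op_add_bounded op_scale_bounded)

lemma op_dist_commute:
  assumes "T \<in> bounded_operators S" "U \<in> bounded_operators S"
  shows "op_dist S T U = op_dist S U T"
proof (rule antisym)
  show "op_dist S T U \<le> op_dist S U T"
    using assms ell2_norm_diff_apply_le[OF assms(2,1)]
    by (intro op_dist_least op_dist_nonneg) (auto simp: ell2_norm_diff_commute[of S "T _"])
  show "op_dist S U T \<le> op_dist S T U"
    using assms ell2_norm_diff_apply_le[OF assms(1,2)]
    by (intro op_dist_least op_dist_nonneg) (auto simp: ell2_norm_diff_commute[of S "U _"])
qed

lemma op_dist_triangle:
  assumes "T \<in> bounded_operators S" "U \<in> bounded_operators S" "W \<in> bounded_operators S"
  shows "op_dist S T W \<le> op_dist S T U + op_dist S U W"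
proof (rule op_dist_least)
  show "0 \<le> op_dist S T U + op_dist S U W" using assms by (simp add: op_dist_nonneg)
  fix f assume f: "f \<in> ell2 S"
  have "ell2_norm S (\<lambda>x. T f x - W f x) \<le>
      ell2_norm S (\<lambda>x. T f x - U f x) + ell2_norm S (\<lambda>x. U f x - W f x)"
    by (intro ell2_norm_diff_triangle bounded_operators_mem[OF _ f] assms)
  also have "\<dots> \<le> op_dist S T U * ell2_norm S f + op_dist S U W * ell2_norm S f"
    by (intro add_mono ell2_norm_diff_apply_le assms f)
  finally show "ell2_norm S (\<lambda>x. T f x - W f x) \<le> (op_dist S T U + op_dist S U W) * ell2_norm S f"
    by (simp add: algebra_simps)
qed

lemma op_dist_le_imp_eq:
  assumes "T \<in> bounded_operators S" "U \<in> bounded_operators S" "op_dist S T U \<le> 0"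
  shows "T = U"
proof (rule bounded_operators_eqI[OF assms(1,2)])
  fix f x assume f: "f \<in> ell2 S"
  have "cmod (T f x - U f x) \<le> ell2_norm S (\<lambda>x. T f x - U f x)"
    using ell2_pointwise_le[OF ell2_diff_mem[OF assms(1,2)[THEN bounded_operators_mem, OF f]]] by simp
  also have "\<dots> \<le> op_dist S T U * ell2_norm S f" by (intro ell2_norm_diff_apply_le assms f)
  also have "\<dots> \<le> 0" using assms(3) ell2_norm_nonneg[of S f] by (simp add: mult_nonpos_nonneg)
  finally show "T f x = U f x" by simp
qed

lemma op_dist_self: "op_dist S T T \<le> 0"
  by (rule op_dist_least) (auto simp: ell2_norm_zero)

lemma op_dist_add:
  assumes "T \<in> bounded_operators S" "U \<in> bounded_operators S"
    "T' \<in> bounded_operators S" "U' \<in> bounded_operators S"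
  shows "op_dist S (op_add S T U) (op_add S T' U') \<le> op_dist S T T' + op_dist S U U'"
proof (rule op_dist_least)
  show "0 \<le> op_dist S T T' + op_dist S U U'" using assms by (simp add: op_dist_nonneg)
  fix f assume f: "f \<in> ell2 S"
  have "ell2_norm S (\<lambda>x. op_add S T U f x - op_add S T' U' f x)
      \<le> ell2_norm S (\<lambda>x. T f x - T' f x) + ell2_norm S (\<lambda>x. U f x - U' f x)"
    using ell2_norm_triangle[of "\<lambda>x. T f x - T' f x" S "\<lambda>x. U f x - U' f x"] f
    by (simp add: op_add_apply algebra_simps ell2_diff_mem assms[THEN bounded_operators_mem, OF f])
  also have "\<dots> \<le> op_dist S T T' * ell2_norm S f + op_dist S U U' * ell2_norm S f"
    by (intro add_mono ell2_norm_diff_apply_le assms f)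
  finally show "ell2_norm S (\<lambda>x. op_add S T U f x - op_add S T' U' f x)
      \<le> (op_dist S T T' + op_dist S U U') * ell2_norm S f"
    by (simp add: algebra_simps)
qed

lemma op_dist_scale:
  assumes "T \<in> bounded_operators S" "T' \<in> bounded_operators S"
  shows "op_dist S (op_scale S c T) (op_scale S c T') \<le> cmod c * op_dist S T T'"
proof (rule op_dist_least)
  show "0 \<le> cmod c * op_dist S T T'" using assms by (simp add: op_dist_nonneg)
  fix f assume f: "f \<in> ell2 S"
  have "ell2_norm S (\<lambda>x. op_scale S c T f x - op_scale S c T' f x)
      = cmod c * ell2_norm S (\<lambda>x. T f x - T' f x)"
    using f by (simp add: op_scale_apply flip: ell2_norm_scale right_diff_distrib)
  also have "\<dots> \<le> cmod c * (op_dist S T T' * ell2_norm S f)"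
    by (intro mult_left_mono ell2_norm_diff_apply_le assms f) auto
  finally show "ell2_norm S (\<lambda>x. op_scale S c T f x - op_scale S c T' f x)
      \<le> (cmod c * op_dist S T T') * ell2_norm S f"
    by (simp add: mult.assoc)
qed

lemma op_dist_mult:
  assumes "T \<in> bounded_operators S" "U \<in> bounded_operators S"
    "T' \<in> bounded_operators S" "U' \<in> bounded_operators S"
  shows "op_dist S (op_mult S T U) (op_mult S T' U')
    \<le> op_dist S T T' * op_norm S U + op_norm S T' * op_dist S U U'"
proof (rule op_dist_least)
  show "0 \<le> op_dist S T T' * op_norm S U + op_norm S T' * op_dist S U U'"
    using assms by (simp add: op_dist_nonneg op_norm_nonneg)
  fix f assume f: "f \<in> ell2 S"
  note m = assms[THEN bounded_operators_mem]
  have "ell2_norm S (\<lambda>x. T (U f) x - T' (U' f) x)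
      \<le> ell2_norm S (\<lambda>x. T (U f) x - T' (U f) x) + ell2_norm S (\<lambda>x. T' (U f) x - T' (U' f) x)"
    by (intro ell2_norm_diff_triangle m f)
  also have "\<dots> \<le> op_dist S T T' * ell2_norm S (U f) + op_norm S T' * ell2_norm S (\<lambda>x. U f x - U' f x)"
    using ell2_norm_apply_le[OF assms(3) ell2_diff_mem[OF m(2)[OF f] m(4)[OF f]]]
      ell2_norm_diff_apply_le[OF assms(1,3) m(2)[OF f]]
      bounded_operators_diff[OF assms(3) m(2)[OF f] m(4)[OF f]] by simp
  also have "\<dots> \<le> op_dist S T T' * (op_norm S U * ell2_norm S f)
      + op_norm S T' * (op_dist S U U' * ell2_norm S f)"
    by (intro add_mono mult_left_mono ell2_norm_diff_apply_le ell2_norm_apply_le assms f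
        op_dist_nonneg op_norm_nonneg)
  finally show "ell2_norm S (\<lambda>x. op_mult S T U f x - op_mult S T' U' f x)
      \<le> (op_dist S T T' * op_norm S U + op_norm S T' * op_dist S U U') * ell2_norm S f"
    using f by (simp add: op_mult_apply algebra_simps)
qed

lemma op_norm_le_op_dist:
  assumes "T \<in> bounded_operators S" "U \<in> bounded_operators S"
  shows "op_norm S T \<le> op_norm S U + op_dist S T U"
proof (rule op_norm_least)
  show "0 \<le> op_norm S U + op_dist S T U" using assms by (simp add: op_dist_nonneg op_norm_nonneg)
  fix f assume f: "f \<in> ell2 S"
  have "ell2_norm S (T f) \<le> ell2_norm S (U f) + ell2_norm S (\<lambda>x. T f x - U f x)"
    using ell2_norm_triangle[OF assms(2)[THEN bounded_operators_mem, OF f]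
      ell2_diff_mem[OF assms[THEN bounded_operators_mem, OF f]]] by simp
  also have "\<dots> \<le> op_norm S U * ell2_norm S f + op_dist S T U * ell2_norm S f"
    by (intro add_mono ell2_norm_diff_apply_le ell2_norm_apply_le assms f)
  finally show "ell2_norm S (T f) \<le> (op_norm S U + op_dist S T U) * ell2_norm S f"
    by (simp add: algebra_simps)
qed

text \<open>A Cauchy sequence of operators converges entrywise, and an estimate on finitely many
  coordinates passes to the limit, uniformly in the set of coordinates.\<close>

lemma bounded_operators_complete:
  assumes T: "\<And>n. T n \<in> bounded_operators S"
    and cauchy: "\<And>e. 0 < e \<Longrightarrow> \<exists>N. \<forall>m\<ge>N. \<forall>n\<ge>N. op_dist S (T m) (T n) < e"
  shows "\<exists>L\<in>bounded_operators S. (\<lambda>n. op_dist S (T n) L) \<longlonglongrightarrow> 0"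
proof -
  define L where "L = (\<lambda>f\<in>ell2 S. \<lambda>u. lim (\<lambda>n. T n f u))"
  have lim: "(\<lambda>n. T n f u) \<longlonglongrightarrow> L f u" if f: "f \<in> ell2 S" for f u
  proof -
    have "Cauchy (\<lambda>n. T n f u)"
    proof (rule metric_CauchyI)
      fix e :: real assume e: "0 < e"
      define e' where "e' = e / (ell2_norm S f + 1)"
      have pos: "0 < ell2_norm S f + 1" using ell2_norm_nonneg[of S f] by linarith
      then obtain N where N: "\<forall>m\<ge>N. \<forall>n\<ge>N. op_dist S (T m) (T n) < e'"
        using cauchy[of e'] e by (auto simp: e'_def)
      show "\<exists>M. \<forall>m\<ge>M. \<forall>n\<ge>M. dist (T m f u) (T n f u) < e"
      proof (intro exI allI impI)
        fix m n assume mn: "N \<le> m" "N \<le> n"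
        have "dist (T m f u) (T n f u) \<le> ell2_norm S (\<lambda>x. T m f x - T n f x)"
          using ell2_pointwise_le[OF ell2_diff_mem[OF T[THEN bounded_operators_mem, OF f] T[THEN bounded_operators_mem, OF f]]]
          by (simp add: dist_norm)
        also have "\<dots> \<le> op_dist S (T m) (T n) * ell2_norm S f"
          by (intro ell2_norm_diff_apply_le T f)
        also have "\<dots> \<le> e' * ell2_norm S f"
          using N mn by (intro mult_right_mono ell2_norm_nonneg) (auto intro: less_imp_le)
        also have "\<dots> < e' * (ell2_norm S f + 1)" using e pos by (intro mult_strict_left_mono) (auto simp: e'_def)
        also have "\<dots> = e" using pos by (simp add: e'_def)
        finally show "dist (T m f u) (T n f u) < e" .
      qed
    qed
    then show ?thesis
      using f by (simp add: L_def Cauchy_convergent_iff convergent_LIMSEQ_iff)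
  qed
  have tail: "(\<lambda>x. T n f x - L f x) \<in> ell2 S \<and> ell2_norm S (\<lambda>x. T n f x - L f x) \<le> e * ell2_norm S f"
    if N: "\<forall>m\<ge>N. op_dist S (T n) (T m) < e" and f: "f \<in> ell2 S" for n N e f
  proof -
    have out: "T n f x - L f x = 0" if "x \<notin> S" for x
    proof -
      have "T m f x = 0" for m using ell2_outside[OF bounded_operators_mem[OF T f] that] .
      then show ?thesis using LIMSEQ_unique[OF lim[OF f, of x], of 0] by simp
    qed
    have bd: "L2_set (\<lambda>x. cmod (T n f x - L f x)) F \<le> e * ell2_norm S f" if F: "finite F" for F
    proof (rule tendsto_upperbound)
      show "(\<lambda>m. L2_set (\<lambda>x. cmod (T n f x - T m f x)) F) \<longlonglongrightarrow> L2_set (\<lambda>x. cmod (T n f x - L f x)) F"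
        unfolding L2_set_def by (intro tendsto_intros lim f)
      show "\<forall>\<^sub>F m in sequentially. L2_set (\<lambda>x. cmod (T n f x - T m f x)) F \<le> e * ell2_norm S f"
        unfolding eventually_sequentially
      proof (intro exI allI impI)
        fix m assume m: "N \<le> m"
        have "L2_set (\<lambda>x. cmod (T n f x - T m f x)) F \<le> ell2_norm S (\<lambda>x. T n f x - T m f x)"
          by (intro ell2_L2_set_le ell2_diff_mem bounded_operators_mem[OF T f] F)
        also have "\<dots> \<le> op_dist S (T n) (T m) * ell2_norm S f"
          by (intro ell2_norm_diff_apply_le T f)
        also have "\<dots> \<le> e * ell2_norm S f"
          using N m by (intro mult_right_mono ell2_norm_nonneg) (auto intro: less_imp_le)
        finally show "L2_set (\<lambda>x. cmod (T n f x - T m f x)) F \<le> e * ell2_norm S f" .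
      qed
    qed simp
    show ?thesis by (intro conjI ell2_memI[OF out bd] ell2_norm_leI[OF out bd])
  qed
  obtain N where N: "\<forall>m\<ge>N. op_dist S (T N) (T m) < 1" using cauchy[of 1] by fastforce
  have L_mem: "L f \<in> ell2 S" if "f \<in> ell2 S" for f
    using ell2_diff_mem[OF bounded_operators_mem[OF T[of N] that] conjunct1[OF tail[OF N that]]] by simp
  have L: "L \<in> bounded_operators S"
  proof (rule bounded_operatorsI[where C = "op_norm S (T N) + 1"])
    fix f assume f: "f \<in> ell2 S"
    show "L f \<in> ell2 S" by (rule L_mem[OF f])
    have "ell2_norm S (L f) \<le> ell2_norm S (T N f) + ell2_norm S (\<lambda>x. L f x - T N f x)"
      using ell2_norm_triangle[OF bounded_operators_mem[OF T[of N] f]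
        ell2_diff_mem[OF L_mem[OF f] bounded_operators_mem[OF T[of N] f]]]
      by simp
    also have "\<dots> \<le> op_norm S (T N) * ell2_norm S f + 1 * ell2_norm S f"
      using tail[OF N f] ell2_norm_diff_commute[of S "L f" "T N f"]
      by (intro add_mono ell2_norm_apply_le T f) simp
    finally show "ell2_norm S (L f) \<le> (op_norm S (T N) + 1) * ell2_norm S f"
      by (simp add: algebra_simps)
    fix g assume g: "g \<in> ell2 S"
    show "L (\<lambda>x. f x + g x) = (\<lambda>x. L f x + L g x)"
    proof
      fix x
      have "(\<lambda>n. T n (\<lambda>x. f x + g x) x) \<longlonglongrightarrow> L f x + L g x"
        by (simp add: bounded_operators_add[OF T f g] tendsto_add lim f g)
      then show "L (\<lambda>x. f x + g x) x = L f x + L g x"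
        by (rule LIMSEQ_unique[OF lim[OF ell2_add_mem[OF f g]]])
    qed
  next
    fix c f assume f: "f \<in> ell2 S"
    show "L (\<lambda>x. c * f x) = (\<lambda>x. c * L f x)"
    proof
      fix x
      have "(\<lambda>n. T n (\<lambda>x. c * f x) x) \<longlonglongrightarrow> c * L f x"
        by (simp add: bounded_operators_scale[OF T f] tendsto_mult_left lim f)
      then show "L (\<lambda>x. c * f x) x = c * L f x"
        by (rule LIMSEQ_unique[OF lim[OF ell2_scale_mem[OF f]]])
    qed
  qed (auto simp: L_def)
  moreover have "(\<lambda>n. op_dist S (T n) L) \<longlonglongrightarrow> 0"
  proof (rule LIMSEQ_I)
    fix e :: real assume e: "0 < e"
    then obtain N where N: "\<forall>m\<ge>N. \<forall>n\<ge>N. op_dist S (T m) (T n) < e/2" using cauchy[of "e/2"] by auto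
    have "op_dist S (T n) L \<le> e/2" if "n \<ge> N" for n
    proof (rule op_dist_least)
      fix f assume "f \<in> ell2 S"
      then show "ell2_norm S (\<lambda>x. T n f x - L f x) \<le> e/2 * ell2_norm S f"
        using tail[of N n "e/2" f] N that by blast
    qed (use e in simp)
    then have "norm (op_dist S (T n) L - 0) < e" if "n \<ge> N" for n
      using that e op_dist_nonneg[OF T[of n] L] by force
    then show "\<exists>N. \<forall>n\<ge>N. norm (op_dist S (T n) L - 0) < e" by blast
  qed
  ultimately show ?thesis by blast
qed

section \<open>Closed algebras generated by shifts\<close>

definition weighted_sum :: "('g \<Rightarrow> complex) \<Rightarrow> (complex \<times> 'g) list \<Rightarrow> complex" where
  "weighted_sum h xs = (\<Sum>(c, s)\<leftarrow>xs. c * h s)"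

definition scale_terms :: "complex \<Rightarrow> (complex \<times> 'g) list \<Rightarrow> (complex \<times> 'g) list" where
  "scale_terms c xs = map (\<lambda>(d, s). (c * d, s)) xs"

definition mult_terms ::
  "(complex \<times> 'g::plus) list \<Rightarrow> (complex \<times> 'g) list \<Rightarrow> (complex \<times> 'g) list" where
  "mult_terms xs ys = concat (map (\<lambda>(c, s). map (\<lambda>(d, t). (c * d, s + t)) ys) xs)"

lemma weighted_sum_Nil [simp]: "weighted_sum h [] = 0"
  and weighted_sum_Cons [simp]: "weighted_sum h ((c, s) # xs) = c * h s + weighted_sum h xs"
  and weighted_sum_append [simp]: "weighted_sum h (xs @ ys) = weighted_sum h xs + weighted_sum h ys"
  by (simp_all add: weighted_sum_def)

lemma weighted_sum_scale_terms [simp]: "weighted_sum h (scale_terms c xs) = c * weighted_sum h xs"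
  by (induction xs) (auto simp: scale_terms_def algebra_simps)

lemma weighted_sum_mult_terms:
  "weighted_sum h (mult_terms xs ys) = weighted_sum (\<lambda>s. weighted_sum (\<lambda>t. h (s + t)) ys) xs"
proof (induction xs)
  case (Cons x xs)
  obtain c s where x: "x = (c, s)" by (cases x)
  have "weighted_sum h (map (\<lambda>(d, t). (c * d, s + t)) ys) = c * weighted_sum (\<lambda>t. h (s + t)) ys"
    by (induction ys) (auto simp: algebra_simps)
  then show ?case using Cons by (simp add: mult_terms_def x)
qed (simp add: mult_terms_def)

lemma weighted_sum_cong:
  "(\<And>s. s \<in> S \<Longrightarrow> h s = k s) \<Longrightarrow> set xs \<subseteq> UNIV \<times> S \<Longrightarrow> weighted_sum h xs = weighted_sum k xs"
  by (induction xs) auto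

lemma weighted_sum_mult_right: "weighted_sum (\<lambda>s. h s * c) xs = weighted_sum h xs * c"
  by (induction xs) (auto simp: algebra_simps)

definition add_submonoid :: "'g::ab_group_add set \<Rightarrow> bool" where
  "add_submonoid S \<longleftrightarrow> 0 \<in> S \<and> (\<forall>s\<in>S. \<forall>t\<in>S. s + t \<in> S)"

lemma add_submonoid_zero: "add_submonoid S \<Longrightarrow> 0 \<in> S"
  and add_submonoid_add: "add_submonoid S \<Longrightarrow> s \<in> S \<Longrightarrow> t \<in> S \<Longrightarrow> s + t \<in> S"
  by (auto simp: add_submonoid_def)

lemma scale_terms_set: "set xs \<subseteq> UNIV \<times> S \<Longrightarrow> set (scale_terms c xs) \<subseteq> UNIV \<times> S"
  by (auto simp: scale_terms_def)

lemma mult_terms_set: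
  "add_submonoid S \<Longrightarrow> set xs \<subseteq> UNIV \<times> S \<Longrightarrow> set ys \<subseteq> UNIV \<times> S \<Longrightarrow> set (mult_terms xs ys) \<subseteq> UNIV \<times> S"
  unfolding mult_terms_def by (auto intro!: add_submonoid_add)

text \<open>A list of coefficients and exponents stands for a polynomial, and the operator below is its
  value at the shifts. Exponents may repeat: sums and products of polynomials are then list
  operations, and \<open>weighted_sum h\<close> turns them into sums and products of values if \<open>h\<close> is
  multiplicative.\<close>

definition fock_comb :: "'g::ab_group_add set \<Rightarrow> (complex \<times> 'g) list \<Rightarrow> 'g operator" where
  "fock_comb S xs = (\<lambda>f\<in>ell2 S. \<lambda>u. weighted_sum (\<lambda>s. f (u - s)) xs)"

lemma fock_bounded:
  fixes P :: "'g::ab_group_add set"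
  assumes s: "\<And>t. t \<in> P \<Longrightarrow> s + t \<in> P"
  shows "fock P s \<in> bounded_operators P"
proof (rule bounded_operatorsI[where C = 1])
  fix f assume f: "f \<in> ell2 P"
  have supp: "s + t \<in> P" if "f t \<noteq> 0" for t using s ell2_outside[OF f] that by blast
  show "fock P s f \<in> ell2 P" using f ell2_shift_mem[OF f supp] by (simp add: fock_def)
  show "ell2_norm P (fock P s f) \<le> 1 * ell2_norm P f"
    using f ell2_norm_shift_le[OF f supp] by (simp add: fock_def)
qed (auto simp: fock_def ell2_add_mem ell2_scale_mem)

context
  fixes S P :: "'g::ab_group_add set"
  assumes S: "add_submonoid S" and P: "add_submonoid P" and SP: "S \<subseteq> P"
begin

lemma fock_mem_bounded: "s \<in> S \<Longrightarrow> fock P s \<in> bounded_operators P"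
  using fock_bounded add_submonoid_add[OF P] SP by blast

lemma fock_comb_Nil: "fock_comb P [] = op_scale P 0 (fock P 0)"
  by (auto simp: fock_comb_def op_scale_def)

lemma fock_comb_Cons:
  "fock_comb P ((c, s) # xs) = op_add P (op_scale P c (fock P s)) (fock_comb P xs)"
  by (auto simp: fock_comb_def op_scale_def op_add_def fock_def)

lemma fock_comb_append: "fock_comb P (xs @ ys) = op_add P (fock_comb P xs) (fock_comb P ys)"
  by (auto simp: fock_comb_def op_add_def)

lemma fock_comb_scale: "fock_comb P (scale_terms c xs) = op_scale P c (fock_comb P xs)"
  by (auto simp: fock_comb_def op_scale_def)

lemma fock_comb_singleton: "fock_comb P [(1, s)] = fock P s"
  by (auto simp: fock_comb_def fock_def)

lemma fock_comb_mem:
  assumes A: "operator_subalgebra P A" "fock P ` S \<subseteq> A" and xs: "set xs \<subseteq> UNIV \<times> S"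
  shows "fock_comb P xs \<in> A"
  using xs
proof (induction xs)
  case Nil
  have "fock P 0 \<in> A" using A(2) add_submonoid_zero[OF S] by auto
  then show ?case using A(1) by (simp add: fock_comb_Nil operator_subalgebra_def)
next
  case (Cons x xs)
  then show ?case using A by (cases x) (auto simp: fock_comb_Cons operator_subalgebra_def)
qed

lemma fock_comb_bounded:
  assumes "set xs \<subseteq> UNIV \<times> S"
  shows "fock_comb P xs \<in> bounded_operators P"
proof (rule fock_comb_mem[OF _ _ assms])
  have "fock P 0 \<in> bounded_operators P" by (intro fock_mem_bounded add_submonoid_zero S)
  then show "operator_subalgebra P (bounded_operators P)"
    by (auto simp: operator_subalgebra_def op_add_bounded op_mult_bounded op_scale_bounded)
qed (auto intro: fock_mem_bounded)

lemma fock_comb_mult: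
  assumes "set ys \<subseteq> UNIV \<times> S"
  shows "fock_comb P (mult_terms xs ys) = op_mult P (fock_comb P xs) (fock_comb P ys)"
proof -
  have "fock_comb P (mult_terms xs ys) f = op_mult P (fock_comb P xs) (fock_comb P ys) f"
    if f: "f \<in> ell2 P" for f
  proof -
    have "fock_comb P ys f \<in> ell2 P" using bounded_operators_mem[OF fock_comb_bounded[OF assms] f] .
    moreover have "fock_comb P ys f = (\<lambda>u. weighted_sum (\<lambda>s. f (u - s)) ys)"
      using f by (simp add: fock_comb_def)
    ultimately show ?thesis
      using f by (simp add: op_mult_apply) (simp add: fock_comb_def weighted_sum_mult_terms algebra_simps)
  qed
  then show ?thesis
    by (intro extensionalityI[of _ "ell2 P"]) (auto simp: fock_comb_def op_mult_def)
qed

lemma op_dist_fock_comb: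
  "op_dist P (fock_comb P xs) (fock_comb P ys) = op_norm P (fock_comb P (xs @ scale_terms (-1) ys))"
  by (simp add: op_dist_def fock_comb_append fock_comb_scale)

end

text \<open>The operators on \<open>\<ell>\<^sup>2(P)\<close> approximable by polynomials in the shifts with exponents in the
  smaller semigroup \<open>S\<close>. For a submonoid \<open>P = S\<close> this is the Fock algebra; for \<open>P\<close> the orthant it is the image
  of the Fock algebra of \<open>S\<close> under the embedding.\<close>

definition shift_algebra :: "'g::ab_group_add set \<Rightarrow> 'g set \<Rightarrow> 'g operator set" where
  "shift_algebra P S = {T \<in> bounded_operators P.
     \<forall>e>0. \<exists>xs. set xs \<subseteq> UNIV \<times> S \<and> op_dist P T (fock_comb P xs) < e}"

lemma shift_algebra_bounded: "T \<in> shift_algebra P S \<Longrightarrow> T \<in> bounded_operators P"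
  by (simp add: shift_algebra_def)

lemma shift_algebra_approx:
  assumes "T \<in> shift_algebra P S" "0 < e"
  obtains xs where "set xs \<subseteq> UNIV \<times> S" "op_dist P T (fock_comb P xs) < e"
  using assms unfolding shift_algebra_def by blast

lemma shift_algebraI:
  assumes "T \<in> bounded_operators P"
    "\<And>e. 0 < e \<Longrightarrow> \<exists>xs. set xs \<subseteq> UNIV \<times> S \<and> op_dist P T (fock_comb P xs) < e"
  shows "T \<in> shift_algebra P S"
  using assms by (simp add: shift_algebra_def)

lemma shift_algebra_mono: "S \<subseteq> S' \<Longrightarrow> shift_algebra P S \<subseteq> shift_algebra P S'"
  unfolding shift_algebra_def by blast

context
  fixes S P :: "'g::ab_group_add set"
  assumes S: "add_submonoid S" and P: "add_submonoid P" and SP: "S \<subseteq> P"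
begin

lemma fock_comb_in_shift_algebra:
  assumes "set xs \<subseteq> UNIV \<times> S"
  shows "fock_comb P xs \<in> shift_algebra P S"
proof (rule shift_algebraI[OF fock_comb_bounded[OF S P SP assms]])
  fix e :: real assume "0 < e"
  then show "\<exists>ys. set ys \<subseteq> UNIV \<times> S \<and> op_dist P (fock_comb P xs) (fock_comb P ys) < e"
    using assms op_dist_self[of P "fock_comb P xs"] by (intro exI[of _ xs]) auto
qed

lemma fock_in_shift_algebra: "s \<in> S \<Longrightarrow> fock P s \<in> shift_algebra P S"
  using fock_comb_in_shift_algebra[of "[(1, s)]"] by (simp add: fock_comb_singleton[OF S P SP])

lemma shift_algebra_approx_seq:
  assumes T: "T \<in> shift_algebra P S"
  obtains xs where "\<And>n. set (xs n) \<subseteq> UNIV \<times> S" "(\<lambda>n. op_dist P T (fock_comb P (xs n))) \<longlonglongrightarrow> 0"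
proof -
  have "\<exists>xs. set xs \<subseteq> UNIV \<times> S \<and> op_dist P T (fock_comb P xs) < inverse (real (Suc n))" for n
    by (rule shift_algebra_approx[OF T, of "inverse (real (Suc n))"]) auto
  then obtain xs where xs: "\<And>n. set (xs n) \<subseteq> UNIV \<times> S"
      "\<And>n. op_dist P T (fock_comb P (xs n)) < inverse (real (Suc n))" by metis
  have "(\<lambda>n. op_dist P T (fock_comb P (xs n))) \<longlonglongrightarrow> 0"
  proof (rule tendsto_sandwich[OF _ _ tendsto_const LIMSEQ_inverse_real_of_nat])
    show "\<forall>\<^sub>F n in sequentially. 0 \<le> op_dist P T (fock_comb P (xs n))"
      using op_dist_nonneg[OF shift_algebra_bounded[OF T] fock_comb_bounded[OF S P SP xs(1)]] by simp
    show "\<forall>\<^sub>F n in sequentially. op_dist P T (fock_comb P (xs n)) \<le> inverse (real (Suc n))"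
      by (intro always_eventually allI less_imp_le xs(2))
  qed
  with xs(1) show thesis by (rule that)
qed

lemma shift_algebra_add:
  assumes T: "T \<in> shift_algebra P S" and U: "U \<in> shift_algebra P S"
  shows "op_add P T U \<in> shift_algebra P S"
proof (rule shift_algebraI)
  note b = shift_algebra_bounded[OF T] shift_algebra_bounded[OF U]
  show "op_add P T U \<in> bounded_operators P" by (intro op_add_bounded b)
  fix e :: real assume e: "0 < e"
  obtain xs where xs: "set xs \<subseteq> UNIV \<times> S" "op_dist P T (fock_comb P xs) < e/2"
    using shift_algebra_approx[OF T, of "e/2"] e by auto
  obtain ys where ys: "set ys \<subseteq> UNIV \<times> S" "op_dist P U (fock_comb P ys) < e/2"
    using shift_algebra_approx[OF U, of "e/2"] e by auto
  have "op_dist P (op_add P T U) (fock_comb P (xs @ ys)) < e"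
    using op_dist_add[OF b fock_comb_bounded[OF S P SP xs(1)] fock_comb_bounded[OF S P SP ys(1)]] xs ys
    by (simp add: fock_comb_append[OF S P SP])
  then show "\<exists>zs. set zs \<subseteq> UNIV \<times> S \<and> op_dist P (op_add P T U) (fock_comb P zs) < e"
    using xs ys by (intro exI[of _ "xs @ ys"]) simp
qed

lemma shift_algebra_scale:
  assumes T: "T \<in> shift_algebra P S"
  shows "op_scale P c T \<in> shift_algebra P S"
proof (rule shift_algebraI)
  note b = shift_algebra_bounded[OF T]
  show "op_scale P c T \<in> bounded_operators P" by (intro op_scale_bounded b)
  fix e :: real assume e: "0 < e"
  have pos: "0 < cmod c + 1" by (simp add: add_nonneg_pos)
  obtain xs where xs: "set xs \<subseteq> UNIV \<times> S" "op_dist P T (fock_comb P xs) < e / (cmod c + 1)"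
    using shift_algebra_approx[OF T, of "e / (cmod c + 1)"] e pos by auto
  have "op_dist P (op_scale P c T) (fock_comb P (scale_terms c xs)) \<le> cmod c * op_dist P T (fock_comb P xs)"
    using op_dist_scale[OF b fock_comb_bounded[OF S P SP xs(1)]] by (simp add: fock_comb_scale[OF S P SP])
  also have "\<dots> \<le> cmod c * (e / (cmod c + 1))" using xs by (intro mult_left_mono) auto
  also have "\<dots> < e" using e pos by (simp add: field_simps)
  finally show "\<exists>zs. set zs \<subseteq> UNIV \<times> S \<and> op_dist P (op_scale P c T) (fock_comb P zs) < e"
    using scale_terms_set[OF xs(1)] by blast
qed

lemma shift_algebra_mult:
  assumes T: "T \<in> shift_algebra P S" and U: "U \<in> shift_algebra P S"
  shows "op_mult P T U \<in> shift_algebra P S"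
proof (rule shift_algebraI)
  note b = shift_algebra_bounded[OF T] shift_algebra_bounded[OF U]
  show "op_mult P T U \<in> bounded_operators P" by (intro op_mult_bounded b)
  fix e :: real assume e: "0 < e"
  have Upos: "0 < op_norm P U + 1" using op_norm_nonneg[OF b(2)] by simp
  obtain xs where xs: "set xs \<subseteq> UNIV \<times> S" "op_dist P T (fock_comb P xs) < e/2 / (op_norm P U + 1)"
    using shift_algebra_approx[OF T, of "e/2 / (op_norm P U + 1)"] e Upos by auto
  note bx = fock_comb_bounded[OF S P SP xs(1)]
  define X where "X = op_norm P (fock_comb P xs)"
  have Xpos: "0 \<le> X" using op_norm_nonneg[OF bx] by (simp add: X_def)
  obtain ys where ys: "set ys \<subseteq> UNIV \<times> S" "op_dist P U (fock_comb P ys) < e/2 / (X + 1)"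
    using shift_algebra_approx[OF U, of "e/2 / (X + 1)"] e Xpos by auto
  note by' = fock_comb_bounded[OF S P SP ys(1)]
  have "op_dist P (op_mult P T U) (fock_comb P (mult_terms xs ys)) \<le>
      op_dist P T (fock_comb P xs) * op_norm P U + X * op_dist P U (fock_comb P ys)"
    using op_dist_mult[OF b bx by'] by (simp add: fock_comb_mult[OF S P SP ys(1)] X_def)
  also have "\<dots> \<le> e/2 / (op_norm P U + 1) * op_norm P U + X * (e/2 / (X + 1))"
    using xs ys Xpos op_norm_nonneg[OF b(2)] by (intro add_mono mult_left_mono mult_right_mono) auto
  also have "\<dots> < e/2 + e/2"
    using e Xpos Upos by (intro add_strict_mono) (auto simp: field_simps)
  finally show "\<exists>zs. set zs \<subseteq> UNIV \<times> S \<and> op_dist P (op_mult P T U) (fock_comb P zs) < e"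
    using mult_terms_set[OF S xs(1) ys(1)] by auto
qed

lemma shift_algebra_subalgebra: "operator_subalgebra P (shift_algebra P S)"
  using fock_in_shift_algebra[OF add_submonoid_zero[OF S]]
  unfolding operator_subalgebra_def
  by (auto intro: shift_algebra_bounded shift_algebra_add shift_algebra_mult shift_algebra_scale)

lemma shift_algebra_closed: "norm_closed P (shift_algebra P S)"
  unfolding norm_closed_def
proof (intro ballI impI shift_algebraI)
  fix T and e :: real
  assume T: "T \<in> bounded_operators P" and *: "\<forall>e>0. \<exists>U\<in>shift_algebra P S. op_dist P T U < e"
    and e: "0 < e"
  obtain U where U: "U \<in> shift_algebra P S" "op_dist P T U < e/2" using * e by (meson half_gt_zero)
  obtain xs where xs: "set xs \<subseteq> UNIV \<times> S" "op_dist P U (fock_comb P xs) < e/2"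
    using shift_algebra_approx[OF U(1), of "e/2"] e by auto
  have "op_dist P T (fock_comb P xs) < e"
    using op_dist_triangle[OF T shift_algebra_bounded[OF U(1)] fock_comb_bounded[OF S P SP xs(1)]] U xs
    by simp
  then show "\<exists>xs. set xs \<subseteq> UNIV \<times> S \<and> op_dist P T (fock_comb P xs) < e" using xs by blast
qed

lemma shift_algebra_least:
  assumes A: "operator_subalgebra P A" "norm_closed P A" "fock P ` S \<subseteq> A"
  shows "shift_algebra P S \<subseteq> A"
proof
  fix T assume T: "T \<in> shift_algebra P S"
  have "\<exists>U\<in>A. op_dist P T U < e" if e: "0 < e" for e
    using shift_algebra_approx[OF T e] fock_comb_mem[OF S P SP A(1,3)] by metis
  then show "T \<in> A" using A(2) shift_algebra_bounded[OF T] by (auto simp: norm_closed_def)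
qed

end

text \<open>The defining intersection is the smallest closed subalgebra containing the shifts; the closure
  of the polynomials is one, and every other one contains it.\<close>

lemma fock_algebra_eq_shift_algebra:
  assumes "add_submonoid S"
  shows "fock_algebra S = shift_algebra S S"
proof
  note S = assms assms order_refl
  show "fock_algebra S \<subseteq> shift_algebra S S"
    unfolding fock_algebra_def
    using shift_algebra_subalgebra[OF S] shift_algebra_closed[OF S] fock_in_shift_algebra[OF S] by blast
  show "shift_algebra S S \<subseteq> fock_algebra S"
    unfolding fock_algebra_def using shift_algebra_least[OF S] by blast
qed

section \<open>Restriction of operators to a smaller space\<close>

lemma ell2_mono:
  assumes "S \<subseteq> P" "f \<in> ell2 S"
  shows ell2_mono_mem: "f \<in> ell2 P" and ell2_mono_norm: "ell2_norm P f = ell2_norm S f"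
proof -
  have "(\<lambda>x. (cmod (f x))\<^sup>2) summable_on P \<longleftrightarrow> (\<lambda>x. (cmod (f x))\<^sup>2) summable_on S"
    by (rule summable_on_cong_neutral) (use assms in \<open>auto simp: ell2_def\<close>)
  then show "f \<in> ell2 P" using assms by (auto simp: ell2_def)
  have "(\<Sum>\<^sub>\<infinity>x\<in>P. (cmod (f x))\<^sup>2) = (\<Sum>\<^sub>\<infinity>x\<in>S. (cmod (f x))\<^sup>2)"
    by (rule infsum_cong_neutral) (use assms in \<open>auto simp: ell2_def\<close>)
  then show "ell2_norm P f = ell2_norm S f" by (simp add: ell2_norm_def)
qed

context
  fixes S P :: "'g::ab_group_add set"
  assumes S: "add_submonoid S" and P: "add_submonoid P" and SP: "S \<subseteq> P"
    and diff: "\<And>t. t \<in> P \<Longrightarrow> \<exists>a\<in>S. \<exists>b\<in>S. t = a - b"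
begin

text \<open>Adding to the shift that works for the earlier points the subtrahend \<open>b\<close> of a new point
  \<open>t = a - b\<close> keeps the earlier points in \<open>S\<close> and brings in \<open>t\<close>.\<close>

lemma shift_finite_into:
  assumes "finite N" "N \<subseteq> P"
  shows "\<exists>s\<in>S. \<forall>t\<in>N. s + t \<in> S"
  using assms
proof (induction N)
  case empty
  then show ?case using add_submonoid_zero[OF S] by blast
next
  case (insert t N)
  then obtain s where s: "s \<in> S" "\<forall>t\<in>N. s + t \<in> S" by auto
  obtain a b where ab: "a \<in> S" "b \<in> S" "t = a - b" using diff[of t] insert.prems by auto
  have "(s + b) + t = s + a" by (simp add: ab(3))
  then have "(s + b) + t \<in> S" using add_submonoid_add[OF S s(1) ab(1)] by (simp only:)
  moreover have "(s + b) + u \<in> S" if "u \<in> N" for u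
    using add_submonoid_add[OF S _ ab(2), of "s + u"] s(2) that by (simp add: algebra_simps)
  ultimately show ?case using add_submonoid_add[OF S s(1) ab(2)] by auto
qed

text \<open>Finitely many coordinates of \<open>p(V) f\<close> depend on finitely many coordinates of \<open>f\<close>; a shift by an
  element of \<open>S\<close> moves the latter into \<open>S\<close>, is isometric, and commutes with \<open>p(V)\<close>.\<close>

lemma op_norm_fock_comb_eq:
  assumes xs: "set xs \<subseteq> UNIV \<times> S"
  shows "op_norm P (fock_comb P xs) = op_norm S (fock_comb S xs)"
proof (rule antisym)
  note bP = fock_comb_bounded[OF S P SP xs] and bS = fock_comb_bounded[OF S S order_refl xs]
  show "op_norm S (fock_comb S xs) \<le> op_norm P (fock_comb P xs)"
  proof (rule op_norm_least[OF op_norm_nonneg[OF bP]])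
    fix f assume f: "f \<in> ell2 S"
    have eq: "fock_comb S xs f = fock_comb P xs f"
      using f ell2_mono_mem[OF SP f] by (simp add: fock_comb_def)
    show "ell2_norm S (fock_comb S xs f) \<le> op_norm P (fock_comb P xs) * ell2_norm S f"
      using ell2_norm_apply_le[OF bP ell2_mono_mem[OF SP f]]
        ell2_mono_norm[OF SP bounded_operators_mem[OF bS f]] ell2_mono_norm[OF SP f]
      by (simp add: eq)
  qed
  show "op_norm P (fock_comb P xs) \<le> op_norm S (fock_comb S xs)"
  proof (rule op_norm_least[OF op_norm_nonneg[OF bS]])
    fix f assume f: "f \<in> ell2 P"
    show "ell2_norm P (fock_comb P xs f) \<le> op_norm S (fock_comb S xs) * ell2_norm P f"
    proof (rule ell2_norm_leI)
      show "fock_comb P xs f x = 0" if "x \<notin> P" for x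
        using ell2_outside[OF bounded_operators_mem[OF bP f] that] .
      fix F assume F: "finite F" "F \<subseteq> P"
      \<comment> \<open>the coordinates of \<open>f\<close> on which the values at \<open>F\<close> depend\<close>
      define N where "N = (\<lambda>(u, s). u - s) ` (F \<times> snd ` set xs) \<inter> P"
      have "finite N" "N \<subseteq> P" using F by (auto simp: N_def)
      then obtain a where a: "a \<in> S" "\<forall>t\<in>N. a + t \<in> S" using shift_finite_into by blast
      define g where "g = (\<lambda>t. if t \<in> N then f t else 0)"
      have g: "g \<in> ell2 P" and g_le: "ell2_norm P g \<le> ell2_norm P f"
      proof -
        have bd: "L2_set (\<lambda>x. cmod (g x)) G \<le> ell2_norm P f" if "finite G" for G
        proof -
          have "L2_set (\<lambda>x. cmod (g x)) G \<le> L2_set (\<lambda>x. cmod (f x)) G"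
            by (intro L2_set_mono) (auto simp: g_def)
          with ell2_L2_set_le[OF f that] show ?thesis by simp
        qed
        have out: "g x = 0" if "x \<notin> P" for x using that by (auto simp: g_def N_def)
        show "g \<in> ell2 P" by (rule ell2_memI[OF out bd])
        show "ell2_norm P g \<le> ell2_norm P f" by (rule ell2_norm_leI[OF out bd])
      qed
      define h where "h = (\<lambda>u. g (u - a))"
      have supp: "a + t \<in> S" if "g t \<noteq> 0" for t
        using a(2) that by (auto simp: g_def split: if_splits)
      have h: "h \<in> ell2 S" and h_le: "ell2_norm S h \<le> ell2_norm P g"
        unfolding h_def using ell2_shift_mem[OF g supp] ell2_norm_shift_le[OF g supp] by auto
      have eq: "fock_comb P xs f u = fock_comb S xs h (u + a)" if u: "u \<in> F" for u
      proof -
        have "f (u - s) = g (u - s)" if "s \<in> snd ` set xs" for s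
          using ell2_outside[OF f, of "u - s"] u that by (force simp: g_def N_def)
        then have "weighted_sum (\<lambda>s. f (u - s)) xs = weighted_sum (\<lambda>s. g (u - s)) xs"
          by (intro weighted_sum_cong[of "snd ` set xs"]) force+
        then show ?thesis using f h by (simp add: fock_comb_def h_def algebra_simps)
      qed
      have "L2_set (\<lambda>x. cmod (fock_comb P xs f x)) F = L2_set (\<lambda>x. cmod (fock_comb S xs h x)) ((\<lambda>u. u + a) ` F)"
        by (simp add: L2_set_def sum.reindex inj_on_def eq)
      also have "\<dots> \<le> ell2_norm S (fock_comb S xs h)"
        by (intro ell2_L2_set_le bounded_operators_mem[OF bS h]) (use F in auto)
      also have "\<dots> \<le> op_norm S (fock_comb S xs) * ell2_norm S h"
        by (intro ell2_norm_apply_le bS h)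
      also have "\<dots> \<le> op_norm S (fock_comb S xs) * ell2_norm P f"
        using h_le g_le by (intro mult_left_mono op_norm_nonneg[OF bS]) auto
      finally show "L2_set (\<lambda>x. cmod (fock_comb P xs f x)) F \<le> op_norm S (fock_comb S xs) * ell2_norm P f" .
    qed
  qed
qed

lemma op_dist_fock_comb_eq:
  assumes "set xs \<subseteq> UNIV \<times> S" "set ys \<subseteq> UNIV \<times> S"
  shows "op_dist P (fock_comb P xs) (fock_comb P ys) = op_dist S (fock_comb S xs) (fock_comb S ys)"
  unfolding op_dist_fock_comb[OF S P SP] op_dist_fock_comb[OF S S order_refl]
  by (rule op_norm_fock_comb_eq) (use assms scale_terms_set[OF assms(2)] in auto)

lemma restrict_fock_comb: "restrict (fock_comb P xs) (ell2 S) = fock_comb S xs"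
  using ell2_mono_mem[OF SP] by (auto simp: fock_comb_def restrict_def)

text \<open>Polynomials with exponents in \<open>S\<close> map \<open>\<ell>\<^sup>2(S)\<close> into itself, and vanishing at a coordinate outside
  \<open>S\<close> is a closed condition.\<close>

lemma shift_algebra_preserves_ell2:
  assumes U: "U \<in> shift_algebra P S" and f: "f \<in> ell2 S"
  shows "U f \<in> ell2 S"
proof -
  note fP = ell2_mono_mem[OF SP f]
  have Uf: "U f \<in> ell2 P" by (rule bounded_operators_mem[OF shift_algebra_bounded[OF U] fP])
  have "U f x = 0" if x: "x \<notin> S" for x
  proof -
    have "cmod (U f x) \<le> 0 + e" if e: "0 < e" for e
    proof -
      have pos: "0 < ell2_norm P f + 1" using ell2_norm_nonneg[of P f] by linarith
      obtain xs where xs: "set xs \<subseteq> UNIV \<times> S" "op_dist P U (fock_comb P xs) < e / (ell2_norm P f + 1)"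
        using shift_algebra_approx[OF U, of "e / (ell2_norm P f + 1)"] e pos by auto
      note b = fock_comb_bounded[OF S P SP xs(1)]
      have "fock_comb P xs f = fock_comb S xs f" using f fP by (simp add: fock_comb_def)
      then have 0: "fock_comb P xs f x = 0"
        using ell2_outside[OF bounded_operators_mem[OF fock_comb_bounded[OF S S order_refl xs(1)] f] x] by simp
      have "cmod (U f x - fock_comb P xs f x) \<le> ell2_norm P (\<lambda>x. U f x - fock_comb P xs f x)"
        by (rule ell2_pointwise_le[OF ell2_diff_mem[OF Uf bounded_operators_mem[OF b fP]]])
      also have "\<dots> \<le> op_dist P U (fock_comb P xs) * ell2_norm P f"
        by (intro ell2_norm_diff_apply_le shift_algebra_bounded[OF U] b fP)
      also have "\<dots> \<le> e / (ell2_norm P f + 1) * ell2_norm P f"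
        using xs by (intro mult_right_mono ell2_norm_nonneg) auto
      also have "\<dots> \<le> e" using pos e by (simp add: field_simps)
      finally show ?thesis by (simp add: 0)
    qed
    then have "cmod (U f x) \<le> 0" by (rule field_le_epsilon)
    then show ?thesis by simp
  qed
  then show ?thesis
    by (intro ell2_memI[where C = "ell2_norm P (U f)"] ell2_L2_set_le[OF Uf]) auto
qed

lemma restrict_bounded:
  assumes U: "U \<in> shift_algebra P S"
  shows "restrict U (ell2 S) \<in> bounded_operators S"
proof (rule bounded_operatorsI[where C = "op_norm P U"])
  note b = shift_algebra_bounded[OF U]
  fix f assume f: "f \<in> ell2 S"
  note fP = ell2_mono_mem[OF SP f]
  show "restrict U (ell2 S) f \<in> ell2 S" using f shift_algebra_preserves_ell2[OF U f] by simp
  show "ell2_norm S (restrict U (ell2 S) f) \<le> op_norm P U * ell2_norm S f"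
    using ell2_norm_apply_le[OF b fP] ell2_mono_norm[OF SP f]
      ell2_mono_norm[OF SP shift_algebra_preserves_ell2[OF U f]] f by simp
qed (use bounded_operators_add[OF shift_algebra_bounded[OF U]] ell2_mono_mem[OF SP]
     bounded_operators_scale[OF shift_algebra_bounded[OF U]]
     in \<open>auto simp: ell2_add_mem ell2_scale_mem\<close>)

lemma op_dist_restrict_le:
  assumes U: "U \<in> shift_algebra P S" and W: "W \<in> shift_algebra P S"
  shows "op_dist S (restrict U (ell2 S)) (restrict W (ell2 S)) \<le> op_dist P U W"
proof (rule op_dist_least)
  show "0 \<le> op_dist P U W" by (intro op_dist_nonneg shift_algebra_bounded[OF U] shift_algebra_bounded[OF W])
  fix f assume f: "f \<in> ell2 S"
  show "ell2_norm S (\<lambda>x. restrict U (ell2 S) f x - restrict W (ell2 S) f x) \<le> op_dist P U W * ell2_norm S f"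
    using ell2_norm_diff_apply_le[OF shift_algebra_bounded[OF U] shift_algebra_bounded[OF W] ell2_mono_mem[OF SP f]]
      ell2_mono_norm[OF SP f] f
      ell2_mono_norm[OF SP ell2_diff_mem[OF shift_algebra_preserves_ell2[OF U f] shift_algebra_preserves_ell2[OF W f]]]
    by simp
qed

lemma restrict_in_shift_algebra:
  assumes U: "U \<in> shift_algebra P S"
  shows "restrict U (ell2 S) \<in> shift_algebra S S"
proof (rule shift_algebraI[OF restrict_bounded[OF U]])
  fix e :: real assume "0 < e"
  then obtain xs where xs: "set xs \<subseteq> UNIV \<times> S" "op_dist P U (fock_comb P xs) < e"
    using shift_algebra_approx[OF U] by blast
  have "op_dist S (restrict U (ell2 S)) (fock_comb S xs) < e"
    using op_dist_restrict_le[OF U fock_comb_in_shift_algebra[OF S P SP xs(1)]] xs(2)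
    by (simp add: restrict_fock_comb)
  with xs show "\<exists>xs. set xs \<subseteq> UNIV \<times> S \<and> op_dist S (restrict U (ell2 S)) (fock_comb S xs) < e" by blast
qed

lemma op_norm_restrict:
  assumes U: "U \<in> shift_algebra P S"
  shows "op_norm S (restrict U (ell2 S)) = op_norm P U"
proof (rule antisym)
  note b = shift_algebra_bounded[OF U] and bS = restrict_bounded[OF U]
  show "op_norm S (restrict U (ell2 S)) \<le> op_norm P U"
  proof (rule op_norm_least[OF op_norm_nonneg[OF b]])
    fix f assume f: "f \<in> ell2 S"
    show "ell2_norm S (restrict U (ell2 S) f) \<le> op_norm P U * ell2_norm S f"
      using ell2_norm_apply_le[OF b ell2_mono_mem[OF SP f]] ell2_mono_norm[OF SP f]
        ell2_mono_norm[OF SP shift_algebra_preserves_ell2[OF U f]] f by simp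
  qed
  show "op_norm P U \<le> op_norm S (restrict U (ell2 S))"
  proof (rule field_le_epsilon)
    fix e :: real assume e: "0 < e"
    obtain xs where xs: "set xs \<subseteq> UNIV \<times> S" "op_dist P U (fock_comb P xs) < e/2"
      using shift_algebra_approx[OF U, of "e/2"] e by auto
    note x = fock_comb_bounded[OF S P SP xs(1)] and xS = fock_comb_bounded[OF S S order_refl xs(1)]
    have "op_norm P U \<le> op_norm P (fock_comb P xs) + op_dist P U (fock_comb P xs)"
      by (rule op_norm_le_op_dist[OF b x])
    also have "op_norm P (fock_comb P xs) = op_norm S (fock_comb S xs)"
      by (rule op_norm_fock_comb_eq[OF xs(1)])
    also have "op_norm S (fock_comb S xs) \<le> op_norm S (restrict U (ell2 S)) + op_dist S (fock_comb S xs) (restrict U (ell2 S))"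
      by (rule op_norm_le_op_dist[OF xS bS])
    also have "op_dist S (fock_comb S xs) (restrict U (ell2 S)) \<le> op_dist P U (fock_comb P xs)"
      using op_dist_restrict_le[OF U fock_comb_in_shift_algebra[OF S P SP xs(1)]]
      by (simp add: restrict_fock_comb op_dist_commute[OF xS bS])
    finally show "op_norm P U \<le> op_norm S (restrict U (ell2 S)) + e" using xs(2) by linarith
  qed
qed

lemma restrict_op_add:
  "restrict (op_add P U W) (ell2 S) = op_add S (restrict U (ell2 S)) (restrict W (ell2 S))"
  using ell2_mono_mem[OF SP] by (auto simp: op_add_def restrict_def)

lemma restrict_op_scale:
  "restrict (op_scale P c U) (ell2 S) = op_scale S c (restrict U (ell2 S))"
  using ell2_mono_mem[OF SP] by (auto simp: op_scale_def restrict_def)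

lemma restrict_op_mult:
  assumes "W \<in> shift_algebra P S"
  shows "restrict (op_mult P U W) (ell2 S) = op_mult S (restrict U (ell2 S)) (restrict W (ell2 S))"
  using ell2_mono_mem[OF SP] shift_algebra_preserves_ell2[OF assms]
  by (auto simp: op_mult_def restrict_def compose_def)

lemma restrict_inj: "inj_on (\<lambda>U. restrict U (ell2 S)) (shift_algebra P S)"
proof (rule inj_onI)
  fix U W assume U: "U \<in> shift_algebra P S" and W: "W \<in> shift_algebra P S"
    and eq: "restrict U (ell2 S) = restrict W (ell2 S)"
  have "op_dist P U W = op_dist S (restrict U (ell2 S)) (restrict W (ell2 S))"
    using op_norm_restrict[OF shift_algebra_add[OF S P SP U shift_algebra_scale[OF S P SP W, of "-1"]]]
    by (simp add: op_dist_def restrict_op_add restrict_op_scale)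
  then have "op_dist P U W \<le> 0" using op_dist_self[of S "restrict W (ell2 S)"] by (simp add: eq)
  then show "U = W"
    by (rule op_dist_le_imp_eq[OF shift_algebra_bounded[OF U] shift_algebra_bounded[OF W]])
qed

text \<open>Polynomials approximating \<open>T\<close> on \<open>\<ell>\<^sup>2(S)\<close> form a Cauchy sequence on \<open>\<ell>\<^sup>2(P)\<close> as well, because
  the norms agree; the limit there restricts to \<open>T\<close>.\<close>

lemma restrict_surj:
  assumes T: "T \<in> shift_algebra S S"
  shows "\<exists>U\<in>shift_algebra P S. restrict U (ell2 S) = T"
proof -
  note bT = shift_algebra_bounded[OF T]
  obtain xs where xs: "\<And>n. set (xs n) \<subseteq> UNIV \<times> S"
    and T_xs: "(\<lambda>n. op_dist S T (fock_comb S (xs n))) \<longlonglongrightarrow> 0"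
    using shift_algebra_approx_seq[OF S S order_refl T] by blast
  note bS = fock_comb_bounded[OF S S order_refl xs] and bP = fock_comb_bounded[OF S P SP xs]
  have "\<exists>U\<in>bounded_operators P. (\<lambda>n. op_dist P (fock_comb P (xs n)) U) \<longlonglongrightarrow> 0"
  proof (rule bounded_operators_complete[OF bP])
    fix e :: real assume e: "0 < e"
    then obtain N where N: "\<forall>n\<ge>N. op_dist S T (fock_comb S (xs n)) < e/2"
      using order_tendstoD(2)[OF T_xs, of "e/2"] by (auto simp: eventually_sequentially)
    have "op_dist P (fock_comb P (xs m)) (fock_comb P (xs n)) < e" if "m \<ge> N" "n \<ge> N" for m n
      using op_dist_triangle[OF bS[of m] bT bS[of n]] N[rule_format, OF that(1)] N[rule_format, OF that(2)]
        op_dist_commute[OF bS[of m] bT] op_dist_fock_comb_eq[OF xs xs, of m n] by linarith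
    then show "\<exists>N. \<forall>m\<ge>N. \<forall>n\<ge>N. op_dist P (fock_comb P (xs m)) (fock_comb P (xs n)) < e" by blast
  qed
  then obtain U where U: "U \<in> bounded_operators P" and lim: "(\<lambda>n. op_dist P (fock_comb P (xs n)) U) \<longlonglongrightarrow> 0"
    by blast
  have U_in: "U \<in> shift_algebra P S"
  proof (rule shift_algebraI[OF U])
    fix e :: real assume "0 < e"
    then obtain n where "op_dist P (fock_comb P (xs n)) U < e"
      using order_tendstoD(2)[OF lim, of e] by (auto simp: eventually_sequentially)
    then show "\<exists>xs. set xs \<subseteq> UNIV \<times> S \<and> op_dist P U (fock_comb P xs) < e"
      using xs[of n] op_dist_commute[OF U bP[of n]] by auto
  qed
  have "op_dist S (restrict U (ell2 S)) T \<le> 0"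
  proof (rule tendsto_lowerbound)
    show "(\<lambda>n. op_dist P (fock_comb P (xs n)) U + op_dist S T (fock_comb S (xs n))) \<longlonglongrightarrow> 0"
      using tendsto_add[OF lim T_xs] by simp
    have "op_dist S (restrict U (ell2 S)) T \<le> op_dist P (fock_comb P (xs n)) U + op_dist S T (fock_comb S (xs n))" for n
      using op_dist_triangle[OF restrict_bounded[OF U_in] bS[of n] bT]
        op_dist_restrict_le[OF U_in fock_comb_in_shift_algebra[OF S P SP xs[of n]]]
        op_dist_commute[OF U bP[of n]] op_dist_commute[OF bS[of n] bT]
      by (simp add: restrict_fock_comb)
    then show "\<forall>\<^sub>F n in sequentially. op_dist S (restrict U (ell2 S)) T
        \<le> op_dist P (fock_comb P (xs n)) U + op_dist S T (fock_comb S (xs n))"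
      by simp
  qed simp
  then have "restrict U (ell2 S) = T"
    by (rule op_dist_le_imp_eq[OF restrict_bounded[OF U_in] bT])
  with U_in show ?thesis by blast
qed

end

section \<open>The isometric embedding of Fock algebras\<close>

lemma fock_algebra_bounded:
  "add_submonoid S \<Longrightarrow> T \<in> fock_algebra S \<Longrightarrow> T \<in> bounded_operators S"
  using shift_algebra_bounded by (simp add: fock_algebra_eq_shift_algebra)

lemma fock_algebra_subalgebra: "add_submonoid S \<Longrightarrow> operator_subalgebra S (fock_algebra S)"
  using shift_algebra_subalgebra[of S S] by (simp add: fock_algebra_eq_shift_algebra)

lemma fock_algebra_add:
  "add_submonoid S \<Longrightarrow> T \<in> fock_algebra S \<Longrightarrow> U \<in> fock_algebra S \<Longrightarrow> op_add S T U \<in> fock_algebra S"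
  and fock_algebra_mult:
  "add_submonoid S \<Longrightarrow> T \<in> fock_algebra S \<Longrightarrow> U \<in> fock_algebra S \<Longrightarrow> op_mult S T U \<in> fock_algebra S"
  and fock_algebra_scale:
  "add_submonoid S \<Longrightarrow> T \<in> fock_algebra S \<Longrightarrow> op_scale S c T \<in> fock_algebra S"
  using fock_algebra_subalgebra[of S] by (auto simp: operator_subalgebra_def)

lemma fock_algebra_closed: "add_submonoid S \<Longrightarrow> norm_closed S (fock_algebra S)"
  using shift_algebra_closed[of S S] by (simp add: fock_algebra_eq_shift_algebra)

lemma fock_in_fock_algebra: "add_submonoid S \<Longrightarrow> s \<in> S \<Longrightarrow> fock S s \<in> fock_algebra S"
  using fock_in_shift_algebra[of S S] by (simp add: fock_algebra_eq_shift_algebra)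

lemma fock_comb_in_fock_algebra:
  "add_submonoid S \<Longrightarrow> set xs \<subseteq> UNIV \<times> S \<Longrightarrow> fock_comb S xs \<in> fock_algebra S"
  using fock_comb_in_shift_algebra[of S S] by (simp add: fock_algebra_eq_shift_algebra)

text \<open>Induction over the Fock algebra: a property of its elements that holds for the shifts and is
  preserved by the algebra operations and by norm limits holds throughout.\<close>

lemma fock_algebra_subset:
  assumes S: "add_submonoid S" and A: "A \<subseteq> fock_algebra S" and fock: "\<And>s. s \<in> S \<Longrightarrow> fock S s \<in> A"
    and ops: "\<And>T U. T \<in> A \<Longrightarrow> U \<in> A \<Longrightarrow> op_add S T U \<in> A" "\<And>T U. T \<in> A \<Longrightarrow> U \<in> A \<Longrightarrow> op_mult S T U \<in> A"
      "\<And>c T. T \<in> A \<Longrightarrow> op_scale S c T \<in> A"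
    and closed: "\<And>T. T \<in> fock_algebra S \<Longrightarrow> (\<And>e. 0 < e \<Longrightarrow> \<exists>U\<in>A. op_dist S T U < e) \<Longrightarrow> T \<in> A"
  shows "fock_algebra S \<subseteq> A"
proof -
  have "norm_closed S A"
    unfolding norm_closed_def
  proof (intro ballI impI closed)
    fix T assume T: "T \<in> bounded_operators S" and approx: "\<forall>e>0. \<exists>U\<in>A. op_dist S T U < e"
    then have "\<forall>e>0. \<exists>U\<in>fock_algebra S. op_dist S T U < e" using A by (meson subsetD)
    then show "T \<in> fock_algebra S" using fock_algebra_closed[OF S] T by (simp add: norm_closed_def)
    show "\<exists>U\<in>A. op_dist S T U < e" if "0 < e" for e using approx that by simp
  qed
  moreover have "operator_subalgebra S A"
    using fock[OF add_submonoid_zero[OF S]] ops fock_algebra_bounded[OF S] A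
    unfolding operator_subalgebra_def by auto
  ultimately show ?thesis using fock unfolding fock_algebra_def by (intro Inter_lower) auto
qed

text \<open>The description by which \<open>fock_embedding\<close> is singled out.\<close>

definition is_fock_embedding :: "'g::ab_group_add set \<Rightarrow> 'g set \<Rightarrow> ('g operator \<Rightarrow> 'g operator) \<Rightarrow> bool" where
  "is_fock_embedding S P \<iota> \<longleftrightarrow> \<iota> \<in> fock_algebra S \<rightarrow>\<^sub>E fock_algebra P \<and>
     (\<forall>T\<in>fock_algebra S. \<forall>U\<in>fock_algebra S. \<iota> (op_add S T U) = op_add P (\<iota> T) (\<iota> U)) \<and>
     (\<forall>c. \<forall>T\<in>fock_algebra S. \<iota> (op_scale S c T) = op_scale P c (\<iota> T)) \<and>
     (\<forall>T\<in>fock_algebra S. \<forall>U\<in>fock_algebra S. \<iota> (op_mult S T U) = op_mult P (\<iota> T) (\<iota> U)) \<and>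
     (\<forall>T\<in>fock_algebra S. op_norm P (\<iota> T) = op_norm S T) \<and>
     (\<forall>s\<in>S. \<iota> (fock S s) = fock P s)"

lemma is_fock_embedding_op_dist:
  assumes "is_fock_embedding S P \<iota>" "add_submonoid S" "T \<in> fock_algebra S" "U \<in> fock_algebra S"
  shows "op_dist P (\<iota> T) (\<iota> U) = op_dist S T U"
  using assms fock_algebra_add[OF assms(2,3) fock_algebra_scale[OF assms(2,4), of "-1"]]
    fock_algebra_scale[OF assms(2,4), of "-1"]
  unfolding is_fock_embedding_def op_dist_def by metis

lemma is_fock_embedding_unique:
  assumes S: "add_submonoid S" and P: "add_submonoid P"
    and i: "is_fock_embedding S P i" and j: "is_fock_embedding S P j"
  shows "i = j"
proof -
  have mem: "i T \<in> bounded_operators P" "j T \<in> bounded_operators P" if "T \<in> fock_algebra S" for T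
    using i j that fock_algebra_bounded[OF P] by (auto simp: is_fock_embedding_def)
  have "fock_algebra S \<subseteq> {T \<in> fock_algebra S. i T = j T}"
  proof (rule fock_algebra_subset[OF S])
    fix T assume T: "T \<in> fock_algebra S"
      and approx: "\<And>e. 0 < e \<Longrightarrow> \<exists>U\<in>{T \<in> fock_algebra S. i T = j T}. op_dist S T U < e"
    have "op_dist P (i T) (j T) \<le> 0 + e" if e: "0 < e" for e
    proof -
      obtain U where U: "U \<in> fock_algebra S" "i U = j U" "op_dist S T U < e/2"
        using approx[OF half_gt_zero[OF e]] by blast
      show ?thesis
        using op_dist_triangle[OF mem(1)[OF T] mem(1)[OF U(1)] mem(2)[OF T]] U
          is_fock_embedding_op_dist[OF i S T U(1)] is_fock_embedding_op_dist[OF j S T U(1)]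
          op_dist_commute[OF mem(2)[OF T] mem(2)[OF U(1)]] by simp
    qed
    then have "op_dist P (i T) (j T) \<le> 0" by (rule field_le_epsilon)
    then show "T \<in> {T \<in> fock_algebra S. i T = j T}"
      using op_dist_le_imp_eq[OF mem[OF T]] T by simp
  qed (use i j in \<open>auto simp: is_fock_embedding_def fock_in_fock_algebra[OF S] fock_algebra_add[OF S]
         fock_algebra_scale[OF S] fock_algebra_mult[OF S]\<close>)
  then show ?thesis
    using i j by (intro extensionalityI[of _ "fock_algebra S"]) (auto simp: is_fock_embedding_def PiE_def)
qed

text \<open>The embedding is the inverse of the restriction of operators to \<open>\<ell>\<^sup>2(S)\<close>, which is a bijection
  from \<open>shift_algebra P S\<close> onto the Fock algebra of \<open>S\<close> compatible with all the operations.\<close>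

lemma is_fock_embedding_exists:
  assumes S: "add_submonoid S" and P: "add_submonoid P" and SP: "S \<subseteq> P"
    and diff: "\<And>t. t \<in> P \<Longrightarrow> \<exists>a\<in>S. \<exists>b\<in>S. t = a - b"
  shows "\<exists>\<iota>. is_fock_embedding S P \<iota>"
proof -
  note ctx = S P SP
  note ctx' = S P SP diff
  define \<rho> where "\<rho> = (\<lambda>U::'a operator. restrict U (ell2 S))"
  define \<iota> where "\<iota> = (\<lambda>T\<in>fock_algebra S. inv_into (shift_algebra P S) \<rho> T)"
  have inj: "inj_on \<rho> (shift_algebra P S)"
    unfolding \<rho>_def by (rule restrict_inj[OF ctx'])
  have img: "\<rho> ` shift_algebra P S = fock_algebra S"
    using restrict_surj[OF ctx'] restrict_in_shift_algebra[OF ctx']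
    unfolding \<rho>_def fock_algebra_eq_shift_algebra[OF S] by blast
  have mem: "\<iota> T \<in> shift_algebra P S" and \<rho>\<iota>: "\<rho> (\<iota> T) = T" if "T \<in> fock_algebra S" for T
    using that inv_into_into[of T \<rho>] f_inv_into_f[of T \<rho>] unfolding \<iota>_def img[symmetric] by auto
  have eqI: "\<iota> T = U" if "U \<in> shift_algebra P S" "\<rho> U = T" for T U
    using that inj img by (auto simp: \<iota>_def)
  have sub: "shift_algebra P S \<subseteq> fock_algebra P"
    using shift_algebra_mono[OF SP] by (simp add: fock_algebra_eq_shift_algebra[OF P])
  have "is_fock_embedding S P \<iota>"
    unfolding is_fock_embedding_def
  proof (intro conjI ballI allI)
    show "\<iota> \<in> fock_algebra S \<rightarrow>\<^sub>E fock_algebra P"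
      using mem sub by (auto simp: \<iota>_def)
    fix T assume T: "T \<in> fock_algebra S"
    show "op_norm P (\<iota> T) = op_norm S T"
      using op_norm_restrict[OF ctx' mem[OF T]] \<rho>\<iota>[OF T] by (simp add: \<rho>_def)
    show "\<iota> (op_scale S c T) = op_scale P c (\<iota> T)" for c
      using \<rho>\<iota>[OF T] restrict_op_scale[OF ctx'] mem[OF T]
      by (intro eqI shift_algebra_scale[OF ctx]) (auto simp: \<rho>_def)
    fix U assume U: "U \<in> fock_algebra S"
    show "\<iota> (op_add S T U) = op_add P (\<iota> T) (\<iota> U)"
      using \<rho>\<iota>[OF T] \<rho>\<iota>[OF U] restrict_op_add[OF ctx'] mem[OF T] mem[OF U]
      by (intro eqI shift_algebra_add[OF ctx]) (auto simp: \<rho>_def)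
    show "\<iota> (op_mult S T U) = op_mult P (\<iota> T) (\<iota> U)"
      using \<rho>\<iota>[OF T] \<rho>\<iota>[OF U] restrict_op_mult[OF ctx' mem[OF U]] mem[OF T] mem[OF U]
      by (intro eqI shift_algebra_mult[OF ctx]) (auto simp: \<rho>_def)
  next
    fix s assume s: "s \<in> S"
    show "\<iota> (fock S s) = fock P s"
      using restrict_fock_comb[OF ctx', of "[(1, s)]"] fock_in_shift_algebra[OF ctx s]
      by (intro eqI) (simp_all add: \<rho>_def fock_comb_singleton[OF ctx] fock_comb_singleton[OF S S])
  qed
  then show ?thesis by blast
qed

lemma fock_embedding_is_fock_embedding:
  assumes "add_submonoid S" "add_submonoid P" "S \<subseteq> P"
    and "\<And>t. t \<in> P \<Longrightarrow> \<exists>a\<in>S. \<exists>b\<in>S. t = a - b"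
  shows "is_fock_embedding S P (fock_embedding S P)"
proof -
  have "\<exists>!\<iota>. is_fock_embedding S P \<iota>"
    using is_fock_embedding_exists[OF assms] is_fock_embedding_unique[OF assms(1,2)] by blast
  then show ?thesis
    unfolding fock_embedding_def is_fock_embedding_def by (rule theI')
qed

section \<open>Characters\<close>

lemma
  assumes "\<phi> \<in> character_space S"
  shows character_extensional: "\<phi> \<in> extensional (fock_algebra S)"
    and character_nonzero: "\<exists>T\<in>fock_algebra S. \<phi> T \<noteq> 0"
    and character_add: "T \<in> fock_algebra S \<Longrightarrow> U \<in> fock_algebra S \<Longrightarrow> \<phi> (op_add S T U) = \<phi> T + \<phi> U"
    and character_scale: "T \<in> fock_algebra S \<Longrightarrow> \<phi> (op_scale S c T) = c * \<phi> T"
    and character_mult: "T \<in> fock_algebra S \<Longrightarrow> U \<in> fock_algebra S \<Longrightarrow> \<phi> (op_mult S T U) = \<phi> T * \<phi> U"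
  using assms by (auto simp: character_space_def)

text \<open>The solution \<open>b\<close> of \<open>a + a b = b\<close> is the sum of the powers of \<open>a\<close>; it is obtained as the fixed point
  of \<open>b \<mapsto> a + a b\<close>, a contraction when \<open>a\<close> has norm below 1.\<close>

lemma fock_algebra_quasi_inverse:
  assumes S: "add_submonoid S" and a: "a \<in> fock_algebra S" and norm_a: "op_norm S a < 1"
  shows "\<exists>b\<in>fock_algebra S. op_add S a (op_mult S a b) = b"
proof -
  define A where "A = fock_algebra S"
  \<comment> \<open>Outside \<open>A\<close> the supremum in \<open>op_dist\<close> may be meaningless, while a metric in the sense of
      \<open>Metric_space\<close> is nonnegative and symmetric on the whole type; hence the value 0 there.\<close>
  define d where "d = (\<lambda>T U. if T \<in> A \<and> U \<in> A then op_dist S T U else 0)"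
  have bd: "T \<in> A \<Longrightarrow> T \<in> bounded_operators S" for T using fock_algebra_bounded[OF S] by (simp add: A_def)
  have metric: "Metric_space A d"
  proof
    show "0 \<le> d T U" for T U by (simp add: d_def bd op_dist_nonneg)
    show "d T U = d U T" for T U by (simp add: d_def bd op_dist_commute)
    show "(d T U = 0) = (T = U)" if "T \<in> A" "U \<in> A" for T U
      using that op_dist_le_imp_eq[OF bd bd, of T U] op_dist_self[of S T] op_dist_nonneg[OF bd bd, of T T]
      by (auto simp: d_def)
    show "d T W \<le> d T U + d U W" if "T \<in> A" "U \<in> A" "W \<in> A" for T U W
      using that by (simp add: d_def bd op_dist_triangle)
  qed
  have complete: "Metric_space.mcomplete A d"
    unfolding Metric_space.mcomplete_def[OF metric]
  proof (intro allI impI)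
    fix \<sigma> assume \<sigma>: "Metric_space.MCauchy A d \<sigma>"
    then have mem: "\<sigma> n \<in> A" for n by (auto simp: Metric_space.MCauchy_def[OF metric])
    have cauchy: "\<exists>N. \<forall>m\<ge>N. \<forall>n\<ge>N. op_dist S (\<sigma> m) (\<sigma> n) < e" if "0 < e" for e
      using \<sigma> that mem unfolding Metric_space.MCauchy_def[OF metric] by (simp add: d_def)
    obtain L where L: "L \<in> bounded_operators S" and lim: "(\<lambda>n. op_dist S (\<sigma> n) L) \<longlonglongrightarrow> 0"
      using bounded_operators_complete[OF bd[OF mem] cauchy] by blast
    have small: "\<exists>N. \<forall>n\<ge>N. op_dist S (\<sigma> n) L < e" if "0 < e" for e
      using order_tendstoD(2)[OF lim that] by (simp add: eventually_sequentially)
    have "\<exists>U\<in>A. op_dist S L U < e" if "0 < e" for e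
      using small[OF that] mem op_dist_commute[OF L bd[OF mem]] by (metis order_refl)
    then have "L \<in> A" using fock_algebra_closed[OF S] L by (simp add: norm_closed_def A_def)
    then have "limitin (Metric_space.mtopology A d) \<sigma> L sequentially"
      unfolding Metric_space.limit_metric_sequentially[OF metric] using small mem by (simp add: d_def)
    then show "\<exists>x. limitin (Metric_space.mtopology A d) \<sigma> x sequentially" by blast
  qed
  have closed: "op_add S a (op_mult S a b) \<in> A" if "b \<in> A" for b
    using that a by (simp add: A_def fock_algebra_add fock_algebra_mult S)
  have "d (op_add S a (op_mult S a b)) (op_add S a (op_mult S a c)) \<le> op_norm S a * d b c"
    if b: "b \<in> A" and c: "c \<in> A" for b c
  proof -
    have a': "a \<in> bounded_operators S" using a bd by (simp add: A_def)
    have "op_dist S (op_add S a (op_mult S a b)) (op_add S a (op_mult S a c)) \<le>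
        op_dist S a a + op_dist S (op_mult S a b) (op_mult S a c)"
      by (intro op_dist_add a' op_mult_bounded bd b c)
    also have "\<dots> \<le> 0 + (op_dist S a a * op_norm S b + op_norm S a * op_dist S b c)"
      by (intro add_mono op_dist_self op_dist_mult a' bd b c)
    also have "\<dots> \<le> op_norm S a * op_dist S b c"
      using op_dist_self[of S a] op_norm_nonneg[OF bd[OF b]] by (simp add: mult_nonpos_nonneg)
    finally show ?thesis using closed b c by (simp add: d_def)
  qed
  note contraction = this
  show ?thesis
  proof (rule Metric_space.Banach_fixedpoint_thm[OF metric complete,
        where f = "\<lambda>b. op_add S a (op_mult S a b)" and k = "op_norm S a"])
    show "A \<noteq> {}" using a by (auto simp: A_def)
    show "(\<lambda>b. op_add S a (op_mult S a b)) \<in> A \<rightarrow> A" using closed by blast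
  qed (use norm_a contraction in \<open>auto simp: A_def\<close>)
qed

lemma op_norm_scale_le:
  assumes "T \<in> bounded_operators S"
  shows "op_norm S (op_scale S c T) \<le> cmod c * op_norm S T"
proof (rule op_norm_least)
  fix f assume "f \<in> ell2 S"
  then show "ell2_norm S (op_scale S c T f) \<le> cmod c * op_norm S T * ell2_norm S f"
    using ell2_norm_apply_le[OF assms, of f]
    by (simp add: op_scale_apply ell2_norm_scale mult.assoc mult_left_mono)
qed (simp add: op_norm_nonneg assms)

text \<open>If \<open>|\<phi>(T)|\<close> exceeded the norm of \<open>T\<close>, then \<open>a = T/\<phi>(T)\<close> would have norm below 1 and \<open>\<phi>(a) = 1\<close>, and
  applying \<open>\<phi>\<close> to \<open>b = a + a b\<close> would give \<open>0 = 1\<close>.\<close>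

lemma character_contractive:
  assumes S: "add_submonoid S" and \<phi>: "\<phi> \<in> character_space S" and T: "T \<in> fock_algebra S"
  shows "cmod (\<phi> T) \<le> op_norm S T"
proof (rule ccontr)
  assume "\<not> ?thesis"
  then have less: "op_norm S T < cmod (\<phi> T)" by simp
  note bT = fock_algebra_bounded[OF S T]
  have pos: "0 < cmod (\<phi> T)" using less op_norm_nonneg[OF bT] by linarith
  define a where "a = op_scale S (1 / \<phi> T) T"
  have a: "a \<in> fock_algebra S" unfolding a_def by (rule fock_algebra_scale[OF S T])
  have \<phi>a: "\<phi> a = 1" using pos by (simp add: a_def character_scale[OF \<phi> T])
  have "op_norm S a \<le> cmod (1 / \<phi> T) * op_norm S T" unfolding a_def by (rule op_norm_scale_le[OF bT])
  also have "\<dots> < 1" using pos less by (simp add: norm_divide field_simps)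
  finally obtain b where b: "b \<in> fock_algebra S" "op_add S a (op_mult S a b) = b"
    using fock_algebra_quasi_inverse[OF S a] by blast
  have "\<phi> b = \<phi> a + \<phi> a * \<phi> b"
    using character_add[OF \<phi> a fock_algebra_mult[OF S a b(1)]] character_mult[OF \<phi> a b(1)] b(2) by simp
  with \<phi>a show False by simp
qed

lemma character_dist_le:
  assumes S: "add_submonoid S" and \<phi>: "\<phi> \<in> character_space S"
    and T: "T \<in> fock_algebra S" and U: "U \<in> fock_algebra S"
  shows "cmod (\<phi> T - \<phi> U) \<le> op_dist S T U"
  using character_contractive[OF S \<phi> fock_algebra_add[OF S T fock_algebra_scale[OF S U, of "-1"]]]
  by (simp add: op_dist_def character_add[OF \<phi> T fock_algebra_scale[OF S U]] character_scale[OF \<phi> U])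

lemma character_eqI:
  assumes S: "add_submonoid S" and \<phi>: "\<phi> \<in> character_space S" and \<psi>: "\<psi> \<in> character_space S"
    and eq: "\<And>s. s \<in> S \<Longrightarrow> \<phi> (fock S s) = \<psi> (fock S s)"
  shows "\<phi> = \<psi>"
proof -
  have "fock_algebra S \<subseteq> {T \<in> fock_algebra S. \<phi> T = \<psi> T}"
  proof (rule fock_algebra_subset[OF S])
    fix T assume T: "T \<in> fock_algebra S"
      and approx: "\<And>e. 0 < e \<Longrightarrow> \<exists>U\<in>{T \<in> fock_algebra S. \<phi> T = \<psi> T}. op_dist S T U < e"
    have "cmod (\<phi> T - \<psi> T) \<le> 0 + e" if e: "0 < e" for e
    proof -
      obtain U where U: "U \<in> fock_algebra S" "\<phi> U = \<psi> U" "op_dist S T U < e/2"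
        using approx[OF half_gt_zero[OF e]] by blast
      have "cmod (\<phi> T - \<psi> T) \<le> cmod (\<phi> T - \<phi> U) + cmod (\<psi> T - \<psi> U)"
        using norm_triangle_ineq4[of "\<phi> T - \<phi> U" "\<psi> T - \<psi> U"] U(2) by simp
      then show ?thesis
        using character_dist_le[OF S \<phi> T U(1)] character_dist_le[OF S \<psi> T U(1)] U(3) by simp
    qed
    then have "cmod (\<phi> T - \<psi> T) \<le> 0" by (rule field_le_epsilon)
    then show "T \<in> {T \<in> fock_algebra S. \<phi> T = \<psi> T}" using T by simp
  qed (auto simp: eq fock_in_fock_algebra[OF S] fock_algebra_add[OF S] fock_algebra_scale[OF S]
      fock_algebra_mult[OF S] character_add[OF \<phi>] character_add[OF \<psi>] character_scale[OF \<phi>]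
      character_scale[OF \<psi>] character_mult[OF \<phi>] character_mult[OF \<psi>])
  then show ?thesis
    using character_extensional[OF \<phi>] character_extensional[OF \<psi>]
    by (intro extensionalityI[of _ "fock_algebra S"]) auto
qed

lemma character_fock_comb:
  assumes S: "add_submonoid S" and \<phi>: "\<phi> \<in> character_space S" and xs: "set xs \<subseteq> UNIV \<times> S"
  shows "\<phi> (fock_comb S xs) = weighted_sum (\<lambda>s. \<phi> (fock S s)) xs"
  using xs
proof (induction xs)
  case Nil
  have "\<phi> (fock_comb S []) = 0 * \<phi> (fock S 0)"
    unfolding fock_comb_Nil[OF S S order_refl]
    by (intro character_scale[OF \<phi>] fock_in_fock_algebra[OF S] add_submonoid_zero[OF S])
  then show ?case by simp
next
  case (Cons x xs)
  obtain c s where x: "x = (c, s)" by (cases x)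
  with Cons.prems have s: "s \<in> S" and xs: "set xs \<subseteq> UNIV \<times> S" by auto
  note f = fock_in_fock_algebra[OF S s]
  show ?case
    using Cons.IH[OF xs] character_add[OF \<phi> fock_algebra_scale[OF S f] fock_comb_in_fock_algebra[OF S xs]]
    by (simp add: x fock_comb_Cons[OF S S order_refl] character_scale[OF \<phi> f])
qed

lemma fock_add:
  assumes S: "add_submonoid S" and s: "s \<in> S" and t: "t \<in> S"
  shows "fock S (s + t) = op_mult S (fock S s) (fock S t)"
proof -
  have "fock S t f \<in> ell2 S" if "f \<in> ell2 S" for f
    using bounded_operators_mem[OF fock_algebra_bounded[OF S fock_in_fock_algebra[OF S t]] that] .
  moreover have "fock S t f = (\<lambda>u. f (u - t))" if "f \<in> ell2 S" for f using that by (simp add: fock_def)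
  ultimately have "fock S (s + t) f = op_mult S (fock S s) (fock S t) f" if "f \<in> ell2 S" for f
    using that by (simp add: op_mult_apply) (simp add: fock_def algebra_simps)
  then show ?thesis
    by (intro extensionalityI[of _ "ell2 S"]) (auto simp: fock_def op_mult_def)
qed

lemma character_fock_add:
  assumes "add_submonoid S" "\<phi> \<in> character_space S" "s \<in> S" "t \<in> S"
  shows "\<phi> (fock S (s + t)) = \<phi> (fock S s) * \<phi> (fock S t)"
  using assms by (simp add: fock_add character_mult fock_in_fock_algebra)

lemma op_norm_fock_le:
  assumes S: "add_submonoid S" and s: "s \<in> S"
  shows "op_norm S (fock S s) \<le> 1"
proof (rule op_norm_least)
  fix f assume f: "f \<in> ell2 S"
  have "s + t \<in> S" if "f t \<noteq> 0" for t
    using that ell2_outside[OF f] add_submonoid_add[OF S s] by blast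
  then show "ell2_norm S (fock S s f) \<le> 1 * ell2_norm S f"
    using f ell2_norm_shift_le[OF f, of s S] by (simp add: fock_def)
qed simp

lemma character_fock_le:
  assumes "add_submonoid S" "\<phi> \<in> character_space S" "s \<in> S"
  shows "cmod (\<phi> (fock S s)) \<le> 1"
  using character_contractive[OF assms(1,2) fock_in_fock_algebra[OF assms(1,3)]]
    op_norm_fock_le[OF assms(1,3)] by simp

lemma character_fock_zero:
  assumes S: "add_submonoid S" and \<phi>: "\<phi> \<in> character_space S"
  shows "\<phi> (fock S 0) = 1"
proof -
  obtain T where T: "T \<in> fock_algebra S" "\<phi> T \<noteq> 0" using character_nonzero[OF \<phi>] by blast
  note b = fock_algebra_bounded[OF S T(1)]
  have "op_mult S T (fock S 0) f = T f" if "f \<in> ell2 S" for f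
    using that by (simp add: op_mult_apply fock_def)
  then have "op_mult S T (fock S 0) = T"
    by (intro extensionalityI[of _ "ell2 S"]) (auto simp: op_mult_def bounded_operators_extensional[OF b])
  then have "\<phi> T * \<phi> (fock S 0) = \<phi> T"
    using character_mult[OF \<phi> T(1) fock_in_fock_algebra[OF S add_submonoid_zero[OF S]]] by simp
  with T(2) show ?thesis by simp
qed

text \<open>A multiplicative function whose values at polynomials are dominated by the norm extends by
  continuity: \<open>\<phi>(T)\<close> is the point within distance \<open>\<Parallel>T - p(V)\<Parallel>\<close> of the value at \<open>p\<close>, for every
  polynomial \<open>p\<close>. Along polynomials converging to \<open>T\<close> the values converge to \<open>\<phi>(T)\<close>, so the algebraic
  identities pass to the limit.\<close>

lemma character_exists:
  assumes S: "add_submonoid S" and \<kappa>0: "\<kappa> 0 = 1"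
    and \<kappa>_add: "\<And>s t. s \<in> S \<Longrightarrow> t \<in> S \<Longrightarrow> \<kappa> (s + t) = \<kappa> s * \<kappa> t"
    and bound: "\<And>xs. set xs \<subseteq> UNIV \<times> S \<Longrightarrow> cmod (weighted_sum \<kappa> xs) \<le> op_norm S (fock_comb S xs)"
  shows "\<exists>\<phi>\<in>character_space S. \<forall>s\<in>S. \<phi> (fock S s) = \<kappa> s"
proof -
  define A where "A = fock_algebra S"
  note SS = S S order_refl
  have A: "A = shift_algebra S S" unfolding A_def by (rule fock_algebra_eq_shift_algebra[OF S])
  have bA: "T \<in> bounded_operators S" if "T \<in> A" for T
    using that fock_algebra_bounded[OF S] by (simp add: A_def)
  have bd: "cmod (weighted_sum \<kappa> xs - weighted_sum \<kappa> ys) \<le> op_dist S (fock_comb S xs) (fock_comb S ys)"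
    if "set xs \<subseteq> UNIV \<times> S" "set ys \<subseteq> UNIV \<times> S" for xs ys
    using bound[of "xs @ scale_terms (-1) ys"] that(1) scale_terms_set[OF that(2), of "-1"]
    by (simp add: op_dist_fock_comb[OF SS])
  have ex: "\<exists>z. \<forall>ys. set ys \<subseteq> UNIV \<times> S \<longrightarrow> cmod (z - weighted_sum \<kappa> ys) \<le> op_dist S T (fock_comb S ys)"
    if T: "T \<in> A" for T
  proof -
    obtain xs where xs: "\<And>n. set (xs n) \<subseteq> UNIV \<times> S" and lim: "(\<lambda>n. op_dist S T (fock_comb S (xs n))) \<longlonglongrightarrow> 0"
      using shift_algebra_approx_seq[OF SS T[unfolded A]] by blast
    have bx: "fock_comb S ys \<in> bounded_operators S" if "set ys \<subseteq> UNIV \<times> S" for ys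
      using fock_comb_bounded[OF SS that] .
    have near: "cmod (weighted_sum \<kappa> (xs n) - weighted_sum \<kappa> ys) \<le>
        op_dist S T (fock_comb S (xs n)) + op_dist S T (fock_comb S ys)"
      if ys: "set ys \<subseteq> UNIV \<times> S" for n ys
      using bd[OF xs[of n] ys] op_dist_triangle[OF bx[OF xs[of n]] bA[OF T] bx[OF ys]]
        op_dist_commute[OF bA[OF T] bx[OF xs[of n]]] by linarith
    have "Cauchy (\<lambda>n. weighted_sum \<kappa> (xs n))"
    proof (rule metric_CauchyI)
      fix e :: real assume e: "0 < e"
      then obtain N where N: "\<forall>n\<ge>N. op_dist S T (fock_comb S (xs n)) < e/2"
        using order_tendstoD(2)[OF lim, of "e/2"] by (auto simp: eventually_sequentially)
      have "dist (weighted_sum \<kappa> (xs m)) (weighted_sum \<kappa> (xs n)) < e" if "m \<ge> N" "n \<ge> N" for m n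
        using near[OF xs[of n], of m] N[rule_format, OF that(1)] N[rule_format, OF that(2)]
        by (simp add: dist_norm)
      then show "\<exists>M. \<forall>m\<ge>M. \<forall>n\<ge>M. dist (weighted_sum \<kappa> (xs m)) (weighted_sum \<kappa> (xs n)) < e" by blast
    qed
    then obtain z where z: "(\<lambda>n. weighted_sum \<kappa> (xs n)) \<longlonglongrightarrow> z"
      using Cauchy_convergent_iff convergent_def by blast
    have "cmod (z - weighted_sum \<kappa> ys) \<le> op_dist S T (fock_comb S ys)" if ys: "set ys \<subseteq> UNIV \<times> S" for ys
    proof (rule LIMSEQ_le)
      show "(\<lambda>n. cmod (weighted_sum \<kappa> (xs n) - weighted_sum \<kappa> ys)) \<longlonglongrightarrow> cmod (z - weighted_sum \<kappa> ys)"
        by (intro tendsto_intros z)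
      show "(\<lambda>n. op_dist S T (fock_comb S (xs n)) + op_dist S T (fock_comb S ys)) \<longlonglongrightarrow> op_dist S T (fock_comb S ys)"
        using tendsto_add[OF lim tendsto_const] by simp
      show "\<exists>N. \<forall>n\<ge>N. cmod (weighted_sum \<kappa> (xs n) - weighted_sum \<kappa> ys) \<le>
          op_dist S T (fock_comb S (xs n)) + op_dist S T (fock_comb S ys)"
        using near[OF ys] by blast
    qed
    then show ?thesis by blast
  qed
  define \<phi> where "\<phi> = (\<lambda>T\<in>A. SOME z. \<forall>ys. set ys \<subseteq> UNIV \<times> S \<longrightarrow>
      cmod (z - weighted_sum \<kappa> ys) \<le> op_dist S T (fock_comb S ys))"
  have near: "cmod (\<phi> T - weighted_sum \<kappa> ys) \<le> op_dist S T (fock_comb S ys)"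
    if "T \<in> A" "set ys \<subseteq> UNIV \<times> S" for T ys
    using someI_ex[OF ex[OF that(1)]] that by (simp add: \<phi>_def)
  have lim_\<phi>: "(\<lambda>n. weighted_sum \<kappa> (xs n)) \<longlonglongrightarrow> \<phi> T"
    if T: "T \<in> A" and xs: "\<And>n. set (xs n) \<subseteq> UNIV \<times> S"
      and lim: "(\<lambda>n. op_dist S T (fock_comb S (xs n))) \<longlonglongrightarrow> 0" for T xs
  proof (rule Lim_null_comparison[THEN LIM_zero_cancel, OF _ lim])
    show "\<forall>\<^sub>F n in sequentially. norm (weighted_sum \<kappa> (xs n) - \<phi> T) \<le> op_dist S T (fock_comb S (xs n))"
      using near[OF T xs] by (simp add: norm_minus_commute)
  qed
  have \<phi>_fock: "\<phi> (fock S s) = \<kappa> s" if s: "s \<in> S" for s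
  proof -
    have "cmod (\<phi> (fock S s) - weighted_sum \<kappa> [(1, s)]) \<le> op_dist S (fock S s) (fock_comb S [(1, s)])"
      by (rule near) (use s in \<open>auto simp: A_def fock_in_fock_algebra[OF S]\<close>)
    also have "\<dots> \<le> 0" unfolding fock_comb_singleton[OF SS] by (rule op_dist_self)
    finally show ?thesis by simp
  qed
  have "\<phi> \<in> character_space S"
    unfolding character_space_def A_def[symmetric]
  proof (intro CollectI conjI ballI allI)
    show "\<phi> \<in> extensional A" by (simp add: \<phi>_def)
    show "\<exists>T\<in>A. \<phi> T \<noteq> 0"
      using \<phi>_fock[OF add_submonoid_zero[OF S]] \<kappa>0 fock_in_fock_algebra[OF S add_submonoid_zero[OF S]]
      by (intro bexI[of _ "fock S 0"]) (auto simp: A_def)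
    fix T assume T: "T \<in> A"
    obtain xs where xs: "\<And>n. set (xs n) \<subseteq> UNIV \<times> S" and limT: "(\<lambda>n. op_dist S T (fock_comb S (xs n))) \<longlonglongrightarrow> 0"
      using shift_algebra_approx_seq[OF SS T[unfolded A]] by blast
    note bT = bA[OF T] and bX = fock_comb_bounded[OF SS xs]
    show "\<phi> (op_scale S c T) = c * \<phi> T" for c
    proof (rule LIMSEQ_unique)
      have cT: "op_scale S c T \<in> A" using T by (simp add: A_def fock_algebra_scale[OF S])
      note sx = scale_terms_set[OF xs, of c]
      have "(\<lambda>n. op_dist S (op_scale S c T) (fock_comb S (scale_terms c (xs n)))) \<longlonglongrightarrow> 0"
      proof (rule tendsto_sandwich[OF _ _ tendsto_const])
        show "(\<lambda>n. cmod c * op_dist S T (fock_comb S (xs n))) \<longlonglongrightarrow> 0"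
          using tendsto_mult_left[OF limT, of "cmod c"] by simp
        show "\<forall>\<^sub>F n in sequentially. 0 \<le> op_dist S (op_scale S c T) (fock_comb S (scale_terms c (xs n)))"
          by (intro always_eventually allI op_dist_nonneg bA[OF cT] fock_comb_bounded[OF SS sx])
        show "\<forall>\<^sub>F n in sequentially. op_dist S (op_scale S c T) (fock_comb S (scale_terms c (xs n)))
            \<le> cmod c * op_dist S T (fock_comb S (xs n))"
          unfolding fock_comb_scale[OF SS] by (intro always_eventually allI op_dist_scale bT bX)
      qed
      then show "(\<lambda>n. weighted_sum \<kappa> (scale_terms c (xs n))) \<longlonglongrightarrow> \<phi> (op_scale S c T)"
        by (rule lim_\<phi>[OF cT sx])
      show "(\<lambda>n. weighted_sum \<kappa> (scale_terms c (xs n))) \<longlonglongrightarrow> c * \<phi> T"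
        using tendsto_mult_left[OF lim_\<phi>[OF T xs limT]] by simp
    qed
    fix U assume U: "U \<in> A"
    obtain ys where ys: "\<And>n. set (ys n) \<subseteq> UNIV \<times> S" and limU: "(\<lambda>n. op_dist S U (fock_comb S (ys n))) \<longlonglongrightarrow> 0"
      using shift_algebra_approx_seq[OF SS U[unfolded A]] by blast
    note bU = bA[OF U] and bY = fock_comb_bounded[OF SS ys]
    show "\<phi> (op_add S T U) = \<phi> T + \<phi> U"
    proof (rule LIMSEQ_unique)
      have TU: "op_add S T U \<in> A" using T U by (simp add: A_def fock_algebra_add[OF S])
      have xys: "set (xs n @ ys n) \<subseteq> UNIV \<times> S" for n using xs ys by simp
      have "(\<lambda>n. op_dist S (op_add S T U) (fock_comb S (xs n @ ys n))) \<longlonglongrightarrow> 0"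
      proof (rule tendsto_sandwich[OF _ _ tendsto_const])
        show "(\<lambda>n. op_dist S T (fock_comb S (xs n)) + op_dist S U (fock_comb S (ys n))) \<longlonglongrightarrow> 0"
          using tendsto_add[OF limT limU] by simp
        show "\<forall>\<^sub>F n in sequentially. 0 \<le> op_dist S (op_add S T U) (fock_comb S (xs n @ ys n))"
          by (intro always_eventually allI op_dist_nonneg bA[OF TU] fock_comb_bounded[OF SS xys])
        show "\<forall>\<^sub>F n in sequentially. op_dist S (op_add S T U) (fock_comb S (xs n @ ys n))
            \<le> op_dist S T (fock_comb S (xs n)) + op_dist S U (fock_comb S (ys n))"
          unfolding fock_comb_append[OF SS] by (intro always_eventually allI op_dist_add bT bU bX bY)
      qed
      then show "(\<lambda>n. weighted_sum \<kappa> (xs n @ ys n)) \<longlonglongrightarrow> \<phi> (op_add S T U)"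
        by (rule lim_\<phi>[OF TU xys])
      show "(\<lambda>n. weighted_sum \<kappa> (xs n @ ys n)) \<longlonglongrightarrow> \<phi> T + \<phi> U"
        using tendsto_add[OF lim_\<phi>[OF T xs limT] lim_\<phi>[OF U ys limU]] by simp
    qed
    show "\<phi> (op_mult S T U) = \<phi> T * \<phi> U"
    proof (rule LIMSEQ_unique)
      have TU: "op_mult S T U \<in> A" using T U by (simp add: A_def fock_algebra_mult[OF S])
      note xys = mult_terms_set[OF S xs ys]
      have "(\<lambda>n. op_dist S (op_mult S T U) (fock_comb S (mult_terms (xs n) (ys n)))) \<longlonglongrightarrow> 0"
      proof (rule tendsto_sandwich[OF _ _ tendsto_const])
        show "(\<lambda>n. op_dist S T (fock_comb S (xs n)) * op_norm S U
            + (op_norm S T + op_dist S T (fock_comb S (xs n))) * op_dist S U (fock_comb S (ys n))) \<longlonglongrightarrow> 0"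
          using tendsto_add[OF tendsto_mult_right[OF limT]
              tendsto_mult[OF tendsto_add[OF tendsto_const limT] limU]] by simp
        show "\<forall>\<^sub>F n in sequentially. 0 \<le> op_dist S (op_mult S T U) (fock_comb S (mult_terms (xs n) (ys n)))"
          by (intro always_eventually allI op_dist_nonneg bA[OF TU] fock_comb_bounded[OF SS xys])
        show "\<forall>\<^sub>F n in sequentially. op_dist S (op_mult S T U) (fock_comb S (mult_terms (xs n) (ys n)))
            \<le> op_dist S T (fock_comb S (xs n)) * op_norm S U
            + (op_norm S T + op_dist S T (fock_comb S (xs n))) * op_dist S U (fock_comb S (ys n))"
        proof (intro always_eventually allI)
          fix n
          have "op_dist S (op_mult S T U) (op_mult S (fock_comb S (xs n)) (fock_comb S (ys n)))
              \<le> op_dist S T (fock_comb S (xs n)) * op_norm S U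
              + op_norm S (fock_comb S (xs n)) * op_dist S U (fock_comb S (ys n))"
            by (intro op_dist_mult bT bU bX bY)
          also have "\<dots> \<le> op_dist S T (fock_comb S (xs n)) * op_norm S U
            + (op_norm S T + op_dist S T (fock_comb S (xs n))) * op_dist S U (fock_comb S (ys n))"
            using op_norm_le_op_dist[OF bX[of n] bT] op_dist_commute[OF bX[of n] bT]
            by (intro add_mono mult_right_mono op_dist_nonneg bU bY) (auto simp: op_norm_nonneg[OF bU])
          finally show "op_dist S (op_mult S T U) (fock_comb S (mult_terms (xs n) (ys n)))
            \<le> op_dist S T (fock_comb S (xs n)) * op_norm S U
            + (op_norm S T + op_dist S T (fock_comb S (xs n))) * op_dist S U (fock_comb S (ys n))"
            unfolding fock_comb_mult[OF SS ys] .
        qed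
      qed
      then show "(\<lambda>n. weighted_sum \<kappa> (mult_terms (xs n) (ys n))) \<longlonglongrightarrow> \<phi> (op_mult S T U)"
        by (rule lim_\<phi>[OF TU xys])
      have "weighted_sum \<kappa> (mult_terms (xs n) (ys n)) = weighted_sum \<kappa> (xs n) * weighted_sum \<kappa> (ys n)" for n
      proof -
        have "weighted_sum (\<lambda>t. \<kappa> (s + t)) (ys n) = \<kappa> s * weighted_sum \<kappa> (ys n)" if "s \<in> S" for s
        proof -
          have "weighted_sum (\<lambda>t. \<kappa> (s + t)) (ys n) = weighted_sum (\<lambda>t. \<kappa> t * \<kappa> s) (ys n)"
            using \<kappa>_add[OF that] by (intro weighted_sum_cong[OF _ ys[of n]]) (simp add: mult.commute)
          then show ?thesis by (simp add: weighted_sum_mult_right mult.commute)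
        qed
        then have "weighted_sum (\<lambda>s. weighted_sum (\<lambda>t. \<kappa> (s + t)) (ys n)) (xs n)
            = weighted_sum (\<lambda>s. \<kappa> s * weighted_sum \<kappa> (ys n)) (xs n)"
          by (intro weighted_sum_cong[OF _ xs[of n]])
        then show ?thesis by (simp add: weighted_sum_mult_terms weighted_sum_mult_right)
      qed
      then show "(\<lambda>n. weighted_sum \<kappa> (mult_terms (xs n) (ys n))) \<longlonglongrightarrow> \<phi> T * \<phi> U"
        using tendsto_mult[OF lim_\<phi>[OF T xs limT] lim_\<phi>[OF U ys limU]] by simp
    qed
  qed
  with \<phi>_fock show ?thesis by blast
qed

text \<open>The vector \<open>k = cnj \<kappa>\<close> on \<open>S\<close> is an eigenvector of the adjoints of the shifts, so the pairing \<open>L\<close>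
  with it turns \<open>p(V)\<close> into multiplication by the value of \<open>\<kappa>\<close> at \<open>p\<close>. Applying \<open>L\<close> to \<open>p(V) k\<close> and using
  the Cauchy-Schwarz inequality gives the bound.\<close>

lemma square_summable_evaluation_bound:
  fixes S :: "'g::ab_group_add set"
  assumes S: "add_submonoid S" and \<kappa>0: "\<kappa> 0 = 1"
    and \<kappa>_add: "\<And>s t. s \<in> S \<Longrightarrow> t \<in> S \<Longrightarrow> \<kappa> (s + t) = \<kappa> s * \<kappa> t"
    and summable: "(\<lambda>t. (cmod (\<kappa> t))\<^sup>2) summable_on S"
    and xs: "set xs \<subseteq> UNIV \<times> S"
  shows "cmod (weighted_sum \<kappa> xs) \<le> op_norm S (fock_comb S xs)"
proof -
  define k where "k = (\<lambda>t. if t \<in> S then cnj (\<kappa> t) else 0)"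
  define K where "K = ell2_norm S k"
  define L where "L = (\<lambda>f. \<Sum>\<^sub>\<infinity>t\<in>S. f t * \<kappa> t)"
  have k: "k \<in> ell2 S"
  proof -
    have "(\<lambda>t. (cmod (k t))\<^sup>2) summable_on S"
      using summable by (rule summable_on_cong[THEN iffD1, rotated]) (simp add: k_def)
    then show ?thesis by (simp add: ell2_def k_def)
  qed
  have K: "0 < K"
    using ell2_pointwise_le[OF k, of 0] \<kappa>0 add_submonoid_zero[OF S] by (simp add: K_def k_def)
  have CS: "(\<Sum>t\<in>F. cmod (f t * \<kappa> t)) \<le> ell2_norm S f * K" if f: "f \<in> ell2 S" and F: "finite F" "F \<subseteq> S" for f F
  proof -
    have "(\<Sum>t\<in>F. cmod (f t * \<kappa> t)) = (\<Sum>t\<in>F. \<bar>cmod (f t)\<bar> * \<bar>cmod (k t)\<bar>)"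
      using F by (intro sum.cong) (auto simp: k_def norm_mult)
    also have "\<dots> \<le> L2_set (\<lambda>t. cmod (f t)) F * L2_set (\<lambda>t. cmod (k t)) F" by (rule L2_set_mult_ineq)
    also have "\<dots> \<le> ell2_norm S f * K"
      unfolding K_def by (intro mult_mono ell2_L2_set_le f k F ell2_norm_nonneg L2_set_nonneg)
    finally show ?thesis .
  qed
  have abs: "(\<lambda>t. cmod (f t * \<kappa> t)) summable_on S" if f: "f \<in> ell2 S" for f
    by (rule nonneg_bdd_above_summable_on) (auto intro!: bdd_aboveI2 CS[OF f])
  have L_le: "cmod (L f) \<le> ell2_norm S f * K" if f: "f \<in> ell2 S" for f
  proof -
    have "cmod (L f) \<le> (\<Sum>\<^sub>\<infinity>t\<in>S. cmod (f t * \<kappa> t))"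
      unfolding L_def by (rule norm_infsum_bound[OF abs[OF f]])
    also have "\<dots> \<le> ell2_norm S f * K" by (rule infsum_le_finite_sums[OF abs[OF f] CS[OF f]])
    finally show ?thesis .
  qed
  have L_shift: "L (\<lambda>u. f (u - s)) = \<kappa> s * L f" if f: "f \<in> ell2 S" and s: "s \<in> S" for f s
  proof -
    have "L (\<lambda>u. f (u - s)) = (\<Sum>\<^sub>\<infinity>u\<in>(+) s ` S. f (u - s) * \<kappa> u)"
      unfolding L_def
    proof (rule infsum_cong_neutral)
      fix u assume "u \<in> S - (+) s ` S"
      then have "u - s \<notin> S" by (metis DiffD2 add_diff_cancel_left' diff_add_cancel imageI add.commute)
      then show "f (u - s) * \<kappa> u = 0" using ell2_outside[OF f] by simp
    next
      fix u assume "u \<in> (+) s ` S - S"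
      then show "f (u - s) * \<kappa> u = 0" using add_submonoid_add[OF S s] by auto
    qed simp
    also have "\<dots> = (\<Sum>\<^sub>\<infinity>t\<in>S. \<kappa> s * (f t * \<kappa> t))"
      by (subst infsum_reindex) (auto intro!: infsum_cong simp: \<kappa>_add[OF s])
    also have "\<dots> = \<kappa> s * L f" by (simp add: L_def infsum_cmult_right')
    finally show ?thesis .
  qed
  have shift_mem: "(\<lambda>u. f (u - s)) \<in> ell2 S" if f: "f \<in> ell2 S" and s: "s \<in> S" for f s
    by (rule ell2_shift_mem[OF f]) (use ell2_outside[OF f] add_submonoid_add[OF S s] in blast)
  have L_comb: "L (fock_comb S xs f) = weighted_sum \<kappa> xs * L f" if f: "f \<in> ell2 S" for f
    using xs
  proof (induction xs)
    case Nil
    show ?case using f by (simp add: fock_comb_def L_def)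
  next
    case (Cons x xs)
    obtain c s where x: "x = (c, s)" by (cases x)
    with Cons.prems have s: "s \<in> S" and xs: "set xs \<subseteq> UNIV \<times> S" by auto
    have comb: "fock_comb S xs f \<in> ell2 S"
      by (rule bounded_operators_mem[OF fock_comb_bounded[OF S S order_refl xs] f])
    have "L (fock_comb S (x # xs) f) = (\<Sum>\<^sub>\<infinity>t\<in>S. c * f (t - s) * \<kappa> t + fock_comb S xs f t * \<kappa> t)"
      unfolding L_def using f by (intro infsum_cong) (simp add: x fock_comb_def algebra_simps)
    also have "\<dots> = (\<Sum>\<^sub>\<infinity>t\<in>S. c * f (t - s) * \<kappa> t) + L (fock_comb S xs f)"
      unfolding L_def
      by (rule infsum_add; rule abs_summable_summable)
        (use abs[OF ell2_scale_mem[OF shift_mem[OF f s], of c]] abs[OF comb] in auto)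
    also have "(\<Sum>\<^sub>\<infinity>t\<in>S. c * f (t - s) * \<kappa> t) = c * L (\<lambda>u. f (u - s))"
      by (simp add: L_def mult.assoc infsum_cmult_right')
    finally show ?case
      using Cons.IH[OF xs] by (simp add: x L_shift[OF f s] algebra_simps)
  qed
  have "L k = complex_of_real (K\<^sup>2)"
  proof -
    have "((\<lambda>t. (cmod (k t))\<^sup>2) has_sum K\<^sup>2) S"
      using k by (auto simp: K_def ell2_norm_def ell2_def infsum_nonneg)
    then have "((\<lambda>t. complex_of_real ((cmod (k t))\<^sup>2)) has_sum complex_of_real (K\<^sup>2)) S"
      by (simp only: has_sum_of_real_iff)
    then have "complex_of_real (K\<^sup>2) = (\<Sum>\<^sub>\<infinity>t\<in>S. complex_of_real ((cmod (k t))\<^sup>2))"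
      by (simp only: infsumI)
    also have "\<dots> = L k"
      unfolding L_def by (intro infsum_cong) (simp add: k_def mult.commute flip: complex_norm_square)
    finally show ?thesis by simp
  qed
  then have "cmod (weighted_sum \<kappa> xs) * K\<^sup>2 = cmod (L (fock_comb S xs k))"
    by (simp add: L_comb[OF k] norm_mult norm_power)
  also have "\<dots> \<le> ell2_norm S (fock_comb S xs k) * K"
    by (intro L_le bounded_operators_mem[OF fock_comb_bounded[OF S S order_refl xs] k])
  also have "\<dots> \<le> (op_norm S (fock_comb S xs) * K) * K"
    unfolding K_def
    by (intro mult_right_mono ell2_norm_apply_le fock_comb_bounded[OF S S order_refl xs] k ell2_norm_nonneg)
  also have "\<dots> = op_norm S (fock_comb S xs) * K\<^sup>2" by (simp add: power2_eq_square)
  finally show ?thesis using K by simp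
qed

section \<open>Point evaluations on the polydisc\<close>

lemma add_submonoid_orthant: "add_submonoid nonneg_orthant"
  by (auto simp: add_submonoid_def nonneg_orthant_def)

lemma monomial_value_zero: "monomial_value \<zeta> 0 = 1"
  by (simp add: monomial_value_def)

lemma monomial_value_add:
  "s \<in> nonneg_orthant \<Longrightarrow> t \<in> nonneg_orthant \<Longrightarrow>
    monomial_value \<zeta> (s + t) = monomial_value \<zeta> s * monomial_value \<zeta> t"
  by (simp add: monomial_value_def nonneg_orthant_def nat_add_distrib power_add prod.distrib)

text \<open>The sum over a box of exponents is a product of finite geometric sums.\<close>

lemma monomial_square_summable:
  fixes \<zeta> :: "complex ^ 'd"
  assumes \<zeta>: "\<And>i. cmod (\<zeta> $ i) < 1"
  shows "(\<lambda>s. (cmod (monomial_value \<zeta> s))\<^sup>2) summable_on nonneg_orthant"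
proof (rule nonneg_bdd_above_summable_on)
  define q where "q = (\<lambda>i. (cmod (\<zeta> $ i))\<^sup>2)"
  have q: "0 \<le> q i" "q i < 1" for i
    using \<zeta>[of i] by (auto simp: q_def power_less_one_iff abs_square_less_1)
  have "(\<Sum>s\<in>F. (cmod (monomial_value \<zeta> s))\<^sup>2) \<le> (\<Prod>i\<in>UNIV. 1 / (1 - q i))"
    if F: "F \<subseteq> nonneg_orthant" "finite F" for F
  proof -
    have "finite ((\<lambda>(s, i). nat (s $ i)) ` (F \<times> (UNIV :: 'd set)))" using F by simp
    then obtain N where "\<forall>n \<in> (\<lambda>(s, i). nat (s $ i)) ` (F \<times> (UNIV :: 'd set)). n < N"
      unfolding finite_nat_set_iff_bounded by blast
    then have N: "nat (s $ i) < N" if "s \<in> F" for s i using that by force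
    define r where "r = (\<lambda>(s :: int ^ 'd) i. nat (s $ i))"
    have inj: "inj_on r F"
    proof (rule inj_onI)
      fix s t assume "s \<in> F" "t \<in> F" and eq: "r s = r t"
      then have "0 \<le> s $ i \<and> 0 \<le> t $ i" for i using F by (auto simp: nonneg_orthant_def)
      with eq show "s = t" unfolding vec_eq_iff r_def by (metis eq_nat_nat_iff)
    qed
    have "(cmod (monomial_value \<zeta> s))\<^sup>2 = (\<Prod>i\<in>UNIV. q i ^ r s i)" for s
      by (simp add: monomial_value_def q_def r_def prod_norm[symmetric] norm_power
          prod_power_distrib flip: power_mult) (simp add: mult.commute)
    then have "(\<Sum>s\<in>F. (cmod (monomial_value \<zeta> s))\<^sup>2) = (\<Sum>h\<in>r ` F. \<Prod>i\<in>UNIV. q i ^ h i)"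
      by (simp add: sum.reindex[OF inj])
    also have "\<dots> \<le> (\<Sum>h\<in>PiE UNIV (\<lambda>_. {..<N}). \<Prod>i\<in>UNIV. q i ^ h i)"
      using N by (intro sum_mono2 finite_PiE prod_nonneg) (auto simp: r_def q)
    also have "\<dots> = (\<Prod>i\<in>UNIV. \<Sum>n<N. q i ^ n)" by (simp add: prod_sum_PiE)
    also have "\<dots> \<le> (\<Prod>i\<in>UNIV. 1 / (1 - q i))"
    proof (intro prod_mono conjI sum_nonneg)
      fix i
      have "(\<Sum>n<N. q i ^ n) \<le> (\<Sum>n. q i ^ n)"
        using q[of i] by (intro sum_le_suminf summable_geometric) auto
      also have "\<dots> = 1 / (1 - q i)" using q[of i] by (intro suminf_geometric) simp
      finally show "(\<Sum>n<N. q i ^ n) \<le> 1 / (1 - q i)" .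
    qed (simp add: q)
    finally show ?thesis .
  qed
  then show "bdd_above (sum (\<lambda>s. (cmod (monomial_value \<zeta> s))\<^sup>2) ` {F. F \<subseteq> nonneg_orthant \<and> finite F})"
    by (intro bdd_aboveI2) blast
qed simp

lemma tendsto_weighted_sum:
  "(\<And>s. ((\<lambda>n. h n s) \<longlongrightarrow> k s) G) \<Longrightarrow> ((\<lambda>n. weighted_sum (h n) xs) \<longlongrightarrow> weighted_sum k xs) G"
  by (induction xs) (auto intro!: tendsto_intros)

text \<open>The monomials at a boundary point are not square summable; the bound there is the limit of
  those at the interior points \<open>r \<zeta>\<close> for \<open>r\<close> tending to 1.\<close>

lemma polydisc_evaluation_bound:
  fixes \<zeta> :: "complex ^ 'd"
  assumes \<zeta>: "\<zeta> \<in> closed_polydisc" and xs: "set xs \<subseteq> UNIV \<times> nonneg_orthant"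
  shows "cmod (weighted_sum (monomial_value \<zeta>) xs) \<le> op_norm nonneg_orthant (fock_comb nonneg_orthant xs)"
proof (rule tendsto_upperbound)
  define r where "r = (\<lambda>n. real n / real (Suc n))"
  define \<eta> where "\<eta> = (\<lambda>n. complex_of_real (r n) *s \<zeta>)"
  have r: "(\<lambda>n. complex_of_real (r n)) \<longlonglongrightarrow> 1"
    using LIMSEQ_n_over_Suc_n[where 'a = complex] by (simp add: r_def)
  have "(\<lambda>n. monomial_value (\<eta> n) s) \<longlonglongrightarrow> monomial_value \<zeta> s" for s
  proof -
    have "(\<lambda>n. monomial_value (\<eta> n) s) \<longlonglongrightarrow> (\<Prod>i\<in>UNIV. (1 * \<zeta> $ i) ^ nat (s $ i))"
      unfolding monomial_value_def \<eta>_def vector_smult_component by (intro tendsto_intros r)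
    then show ?thesis by (simp add: monomial_value_def)
  qed
  then show "(\<lambda>n. cmod (weighted_sum (monomial_value (\<eta> n)) xs)) \<longlonglongrightarrow> cmod (weighted_sum (monomial_value \<zeta>) xs)"
    by (intro tendsto_norm tendsto_weighted_sum)
  have "cmod (\<eta> n $ i) < 1" for n i
  proof -
    have "0 \<le> r n" by (simp add: r_def)
    then have "cmod (\<eta> n $ i) = r n * cmod (\<zeta> $ i)" by (simp add: \<eta>_def norm_mult)
    also have "\<dots> \<le> r n * 1" using \<zeta> by (intro mult_left_mono) (auto simp: closed_polydisc_def r_def)
    also have "\<dots> < 1" by (simp add: r_def)
    finally show ?thesis .
  qed
  then have "cmod (weighted_sum (monomial_value (\<eta> n)) xs)
      \<le> op_norm nonneg_orthant (fock_comb nonneg_orthant xs)" for n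
    by (intro square_summable_evaluation_bound add_submonoid_orthant monomial_value_zero
        monomial_value_add monomial_square_summable xs)
  then show "\<forall>\<^sub>F n in sequentially. cmod (weighted_sum (monomial_value (\<eta> n)) xs)
      \<le> op_norm nonneg_orthant (fock_comb nonneg_orthant xs)"
    by simp
qed simp

lemma point_evaluation_character:
  assumes \<zeta>: "\<zeta> \<in> closed_polydisc"
  shows "point_evaluation \<zeta> \<in> character_space nonneg_orthant"
    and "s \<in> nonneg_orthant \<Longrightarrow> point_evaluation \<zeta> (fock nonneg_orthant s) = monomial_value \<zeta> s"
proof -
  have "\<exists>\<phi>\<in>character_space nonneg_orthant. \<forall>s\<in>nonneg_orthant.
      \<phi> (fock nonneg_orthant s) = monomial_value \<zeta> s"
    by (intro character_exists add_submonoid_orthant monomial_value_zero monomial_value_add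
        polydisc_evaluation_bound \<zeta>)
  then have "\<exists>!\<phi>. \<phi> \<in> character_space nonneg_orthant \<and>
     (\<forall>s\<in>nonneg_orthant. \<phi> (fock nonneg_orthant s) = monomial_value \<zeta> s)"
    using character_eqI[OF add_submonoid_orthant] by metis
  from theI'[OF this] show "point_evaluation \<zeta> \<in> character_space nonneg_orthant"
    and "s \<in> nonneg_orthant \<Longrightarrow> point_evaluation \<zeta> (fock nonneg_orthant s) = monomial_value \<zeta> s"
    by (auto simp: point_evaluation_def)
qed

section \<open>The restriction map to the characters of the cone\<close>

lemma positive_cone_add_submonoid: "positive_cone S \<Longrightarrow> add_submonoid S"
  by (auto simp: positive_cone_def add_submonoid_def)

context
  fixes S :: "(int ^ 'd) set"
  assumes cone: "positive_cone S" and orthant: "S \<subseteq> nonneg_orthant"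
begin

lemma cone_submonoid: "add_submonoid S"
  by (rule positive_cone_add_submonoid[OF cone])

lemma cone_embedding: "is_fock_embedding S nonneg_orthant (fock_embedding S nonneg_orthant)"
  by (rule fock_embedding_is_fock_embedding[OF cone_submonoid add_submonoid_orthant orthant])
    (use cone in \<open>auto simp: positive_cone_def\<close>)

lemma iota_star_fock:
  assumes \<zeta>: "\<zeta> \<in> closed_polydisc" and s: "s \<in> S"
  shows "iota_star S \<zeta> (fock S s) = monomial_value \<zeta> s"
  using cone_embedding s orthant fock_in_fock_algebra[OF cone_submonoid s]
  by (auto simp: iota_star_def is_fock_embedding_def point_evaluation_character(2)[OF \<zeta>])

lemma iota_star_character:
  assumes \<zeta>: "\<zeta> \<in> closed_polydisc"
  shows "iota_star S \<zeta> \<in> character_space S"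
proof -
  note ev = point_evaluation_character(1)[OF \<zeta>]
  note emb = cone_embedding[unfolded is_fock_embedding_def]
  have mem: "fock_embedding S nonneg_orthant T \<in> fock_algebra nonneg_orthant" if "T \<in> fock_algebra S" for T
    using emb that by blast
  have zero: "fock S 0 \<in> fock_algebra S"
    by (intro fock_in_fock_algebra cone_submonoid add_submonoid_zero)
  have "iota_star S \<zeta> (fock S 0) = 1"
    using iota_star_fock[OF \<zeta> add_submonoid_zero[OF cone_submonoid]] by (simp add: monomial_value_zero)
  then have "\<exists>T\<in>fock_algebra S. iota_star S \<zeta> T \<noteq> 0" using zero by (intro bexI[of _ "fock S 0"]) auto
  then show ?thesis
    using emb mem unfolding character_space_def iota_star_def
    by (auto simp: fock_algebra_add fock_algebra_mult fock_algebra_scale cone_submonoid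
        character_add[OF ev] character_mult[OF ev] character_scale[OF ev])
qed

lemma iota_star_eq_iff:
  assumes "\<zeta> \<in> closed_polydisc" "\<eta> \<in> closed_polydisc"
  shows "iota_star S \<zeta> = iota_star S \<eta> \<longleftrightarrow> (\<forall>s\<in>S. monomial_value \<zeta> s = monomial_value \<eta> s)"
  using character_eqI[OF cone_submonoid iota_star_character iota_star_character, OF assms]
    iota_star_fock assms by metis

text \<open>The estimate is uniform in \<open>\<zeta>\<close>, so it exhibits \<open>\<zeta> \<mapsto> \<iota>\<^sup>*(\<zeta>)(T)\<close> as a uniform limit of polynomials.\<close>

lemma iota_star_approx:
  assumes \<zeta>: "\<zeta> \<in> closed_polydisc" and T: "T \<in> fock_algebra S" and xs: "set xs \<subseteq> UNIV \<times> S"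
  shows "cmod (iota_star S \<zeta> T - weighted_sum (monomial_value \<zeta>) xs) \<le> op_dist S T (fock_comb S xs)"
proof -
  have "iota_star S \<zeta> (fock_comb S xs) = weighted_sum (monomial_value \<zeta>) xs"
    using character_fock_comb[OF cone_submonoid iota_star_character[OF \<zeta>] xs]
      weighted_sum_cong[OF iota_star_fock[OF \<zeta>] xs] by simp
  then show ?thesis
    using character_dist_le[OF cone_submonoid iota_star_character[OF \<zeta>] T
        fock_comb_in_fock_algebra[OF cone_submonoid xs]] by simp
qed

lemma continuous_on_weighted_monomials:
  "continuous_on A (\<lambda>\<zeta>. weighted_sum (monomial_value \<zeta>) xs)"
proof (induction xs)
  case (Cons x xs)
  then show ?case
    by (cases x) (auto simp: monomial_value_def intro!: continuous_intros)
qed simp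

lemma continuous_iota_star:
  "continuous_map (top_of_set closed_polydisc) (character_topology S) (iota_star S)"
proof -
  have "continuous_on closed_polydisc (\<lambda>\<zeta>. iota_star S \<zeta> T)" if T: "T \<in> fock_algebra S" for T
  proof -
    obtain xs where xs: "\<And>n. set (xs n) \<subseteq> UNIV \<times> S" and lim: "(\<lambda>n. op_dist S T (fock_comb S (xs n))) \<longlonglongrightarrow> 0"
      using shift_algebra_approx_seq[OF cone_submonoid cone_submonoid order_refl] T
      unfolding fock_algebra_eq_shift_algebra[OF cone_submonoid] by blast
    show ?thesis
    proof (rule uniform_limit_theorem)
      show "\<forall>\<^sub>F n in sequentially. continuous_on closed_polydisc (\<lambda>\<zeta>. weighted_sum (monomial_value \<zeta>) (xs n))"
        by (intro always_eventually allI continuous_on_weighted_monomials)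
      show "uniform_limit closed_polydisc (\<lambda>n \<zeta>. weighted_sum (monomial_value \<zeta>) (xs n))
          (\<lambda>\<zeta>. iota_star S \<zeta> T) sequentially"
      proof (rule uniform_limitI)
        fix e :: real assume "0 < e"
        from order_tendstoD(2)[OF lim this]
        show "\<forall>\<^sub>F n in sequentially. \<forall>\<zeta>\<in>closed_polydisc.
            dist (weighted_sum (monomial_value \<zeta>) (xs n)) (iota_star S \<zeta> T) < e"
          by eventually_elim
            (use iota_star_approx[OF _ T xs] in \<open>auto simp: dist_norm norm_minus_commute intro: le_less_trans\<close>)
      qed
    qed simp
  qed
  then show ?thesis
    using iota_star_character
    by (auto simp: character_topology_def continuous_map_in_subtopology continuous_map_componentwise
        iota_star_def)
qed

lemma Hausdorff_character_topology: "Hausdorff_space (character_topology S)"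
  unfolding character_topology_def
  by (intro Hausdorff_space_subtopology) (simp add: Hausdorff_space_product_topology)

end

lemma topspace_character_topology: "topspace (character_topology S) = character_space S"
  by (auto simp: character_topology_def character_space_def PiE_def)

lemma compact_closed_polydisc: "compact (closed_polydisc :: (complex ^ 'd) set)"
proof -
  have "closed (\<Inter>i. {\<zeta> :: complex ^ 'd. cmod (\<zeta> $ i) \<le> 1})"
    by (intro closed_INT ballI closed_Collect_le continuous_intros)
  moreover have "closed_polydisc = (\<Inter>i. {\<zeta> :: complex ^ 'd. cmod (\<zeta> $ i) \<le> 1})"
    by (auto simp: closed_polydisc_def)
  ultimately have "closed (closed_polydisc :: (complex ^ 'd) set)" by (simp only:)
  moreover have "bounded (closed_polydisc :: (complex ^ 'd) set)"
  proof (rule boundedI)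
    fix \<zeta> :: "complex ^ 'd" assume "\<zeta> \<in> closed_polydisc"
    then have "(\<Sum>i\<in>UNIV. norm (\<zeta> $ i)) \<le> (\<Sum>i\<in>(UNIV :: 'd set). 1)"
      by (intro sum_mono) (auto simp: closed_polydisc_def)
    then show "norm \<zeta> \<le> real CARD('d)" 
      using L2_set_le_sum[of UNIV "\<lambda>i. norm (\<zeta> $ i)"] by (simp add: norm_vec_def)
  qed
  ultimately show ?thesis by (simp add: compact_eq_bounded_closed)
qed

section \<open>Intersections with the axes\<close>

lemma sum_const_vec: "(\<Sum>k<n. g) = int n *s (g :: int ^ 'd)"
  by (induction n) (auto simp: vec_eq_iff algebra_simps)

lemma seminormalization_iff:
  "g \<in> seminormalization S \<longleftrightarrow> (\<forall>\<^sub>F n in sequentially. int n *s (g :: int ^ 'd) \<in> S)"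
  unfolding seminormalization_def sum_const_vec by simp

lemma axis_multiple_nth: "(n *s axis i (1 :: int)) $ j = (if j = i then n else 0)"
  by (simp add: axis_def)

lemma orthant_eq_sum_axes: "(v :: int ^ 'd) = (\<Sum>i\<in>UNIV. v $ i *s axis i 1)"
  by (simp add: vec_eq_iff axis_def if_distrib cong: if_cong)

lemma axis_multiple_add: "(m + n) *s axis i (1 :: int) = m *s axis i 1 + n *s axis i 1"
  by (simp add: vec_eq_iff algebra_simps)

lemma add_submonoid_sum:
  "add_submonoid S \<Longrightarrow> (\<And>i. i \<in> I \<Longrightarrow> f i \<in> S) \<Longrightarrow> sum f I \<in> S"
  by (induction I rule: infinite_finite_induct) (auto simp: add_submonoid_zero add_submonoid_add)

lemma add_submonoid_multiple: "add_submonoid A \<Longrightarrow> a \<in> A \<Longrightarrow> int k * a \<in> A"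
  by (induction k) (auto simp: add_submonoid_zero add_submonoid_add algebra_simps)

text \<open>If \<open>a\<close> and \<open>a + 1\<close> both belong to \<open>A\<close>, then \<open>g = g (a + 1) - g a\<close> is a difference of elements of \<open>A\<close>.\<close>

lemma positive_cone_int_iff:
  assumes A: "add_submonoid (A :: int set)" "A \<subseteq> {0..}"
  shows "positive_cone A \<longleftrightarrow> (\<exists>a\<in>A. a + 1 \<in> A)"
proof
  assume "positive_cone A"
  then obtain s t where "s \<in> A" "t \<in> A" "1 = s - t" unfolding positive_cone_def by blast
  then have "t \<in> A \<and> t + 1 \<in> A" by (simp add: algebra_simps)
  then show "\<exists>a\<in>A. a + 1 \<in> A" by blast
next
  assume "\<exists>a\<in>A. a + 1 \<in> A"
  then obtain a where a: "a \<in> A" "a + 1 \<in> A" by blast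
  have "\<exists>s\<in>A. \<exists>t\<in>A. g = s - t" for g
  proof (cases "0 \<le> g")
    case True
    then have "g * (a + 1) \<in> A" "g * a \<in> A"
      using add_submonoid_multiple[OF A(1) a(1), of "nat g"] add_submonoid_multiple[OF A(1) a(2), of "nat g"] by auto
    moreover have "g = g * (a + 1) - g * a" by (simp add: algebra_simps)
    ultimately show ?thesis by blast
  next
    case False
    then have "(- g) * (a + 1) \<in> A" "(- g) * a \<in> A"
      using add_submonoid_multiple[OF A(1) a(1), of "nat (- g)"] add_submonoid_multiple[OF A(1) a(2), of "nat (- g)"] by auto
    moreover have "g = (- g) * a - (- g) * (a + 1)" by (simp add: algebra_simps)
    ultimately show ?thesis by blast
  qed
  moreover have "A \<inter> uminus ` A = {0}"
  proof (intro equalityI subsetI)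
    fix x assume "x \<in> A \<inter> uminus ` A"
    then have "x \<in> A" "- x \<in> A" by auto
    with A(2) have "0 \<le> x" "0 \<le> - x" by auto
    then show "x \<in> {0}" by simp
  qed (use add_submonoid_zero[OF A(1)] in force)
  ultimately show "positive_cone A"
    using A(1) by (auto simp: positive_cone_def add_submonoid_def)
qed

text \<open>Two consecutive members \<open>a\<close> and \<open>a + 1\<close> suffice: if \<open>n = q a + r\<close> with \<open>r < a \<le> q\<close>,
  then \<open>n = (q - r) a + r (a + 1)\<close>.\<close>

lemma eventually_mem_of_consecutive:
  assumes A: "add_submonoid (A :: int set)" and a: "int a \<in> A" "int a + 1 \<in> A"
  shows "\<forall>\<^sub>F n in sequentially. int n \<in> A"
  unfolding eventually_sequentially
proof (intro exI allI impI)
  fix n assume n: "a * a \<le> n"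
  show "int n \<in> A"
  proof (cases "a = 0")
    case True
    then show ?thesis using add_submonoid_multiple[OF A a(2), of n] by simp
  next
    case False
    define q r where "q = n div a" and "r = n mod a"
    have "a \<le> q" unfolding q_def using n False by (simp add: less_eq_div_iff_mult_less_eq)
    moreover have "r < a" using False by (simp add: r_def)
    ultimately have rq: "r \<le> q" by simp
    have "n = q * a + r" by (simp add: q_def r_def)
    then have "int n = int (q - r) * int a + int r * (int a + 1)"
      using rq by (simp add: of_nat_diff algebra_simps)
    then show ?thesis
      using add_submonoid_add[OF A add_submonoid_multiple[OF A a(1)] add_submonoid_multiple[OF A a(2)]] by simp
  qed
qed

lemma positive_cone_int_iff_eventually:
  assumes A: "add_submonoid (A :: int set)" "A \<subseteq> {0..}"
  shows "positive_cone A \<and> A \<noteq> {0} \<longleftrightarrow> (\<forall>\<^sub>F n in sequentially. int n \<in> A)"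
proof
  assume "positive_cone A \<and> A \<noteq> {0}"
  then obtain a where "a \<in> A" "a + 1 \<in> A" using positive_cone_int_iff[OF A] by blast
  moreover from this A(2) obtain b where "a = int b" using zero_le_imp_eq_int by force
  ultimately show "\<forall>\<^sub>F n in sequentially. int n \<in> A" using eventually_mem_of_consecutive[OF A(1)] by blast
next
  assume "\<forall>\<^sub>F n in sequentially. int n \<in> A"
  then obtain N where N: "\<And>n. n \<ge> N \<Longrightarrow> int n \<in> A" by (auto simp: eventually_sequentially)
  have "int N \<in> A" "int N + 1 \<in> A" using N[of N] N[of "Suc N"] by (auto simp: algebra_simps)
  then show "positive_cone A \<and> A \<noteq> {0}" using positive_cone_int_iff[OF A] by fastforce
qed

text \<open>The differences of elements of \<open>A\<close> form a subgroup of the integers, which is proper because \<open>A\<close> is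
  not a nontrivial cone. Its least positive element serves as \<open>k\<close>, or 2 if it has none.\<close>

lemma common_divisor_of_not_cone:
  assumes A: "add_submonoid (A :: int set)" "A \<subseteq> {0..}"
    and not: "\<not> (positive_cone A \<and> A \<noteq> {0})"
  shows "\<exists>k::nat. 2 \<le> k \<and> (\<forall>a\<in>A. int k dvd a)"
proof (cases "A \<subseteq> {0}")
  case True
  then show ?thesis by (intro exI[of _ 2]) auto
next
  case False
  define G where "G = {a - b | a b. a \<in> A \<and> b \<in> A}"
  have AG: "A \<subseteq> G" using add_submonoid_zero[OF A(1)] by (force simp: G_def)
  have G_diff: "x - y \<in> G" if x: "x \<in> G" and y: "y \<in> G" for x y
  proof -
    obtain a b where "a \<in> A" "b \<in> A" "x = a - b" using x unfolding G_def by blast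
    moreover obtain c d where "c \<in> A" "d \<in> A" "y = c - d" using y unfolding G_def by blast
    ultimately have "x - y = (a + d) - (b + c)" "a + d \<in> A" "b + c \<in> A" by (auto intro: add_submonoid_add[OF A(1)])
    then show ?thesis unfolding G_def by blast
  qed
  have G0: "0 \<in> G" using AG add_submonoid_zero[OF A(1)] by blast
  have "1 \<notin> G"
  proof
    assume "1 \<in> G"
    then obtain a b where ab: "a \<in> A" "b \<in> A" "1 = a - b" unfolding G_def by blast
    then have "b + 1 \<in> A" by (simp add: algebra_simps)
    with ab(2) have "positive_cone A" using positive_cone_int_iff[OF A] by blast
    with not False show False by auto
  qed
  obtain m where "m \<in> A" "m \<noteq> 0" using False by blast
  then have m: "0 < nat m \<and> int (nat m) \<in> G" using A(2) AG by force
  define k where "k = (LEAST k. 0 < k \<and> int k \<in> G)"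
  have k: "0 < k \<and> int k \<in> G" unfolding k_def by (rule LeastI[of "\<lambda>k. 0 < k \<and> int k \<in> G"]) (rule m)
  have least: "k \<le> j" if "0 < j" "int j \<in> G" for j
    unfolding k_def using that by (intro Least_le) simp
  have multiple: "int j * int k \<in> G" for j
  proof (induction j)
    case (Suc j)
    have "int (Suc j) * int k = int j * int k - (0 - int k)" by (simp add: algebra_simps)
    then show ?case using G_diff[OF Suc G_diff[OF G0]] k by simp
  qed (simp add: G0)
  have "int k dvd a" if a: "a \<in> A" for a
  proof -
    have "0 \<le> a" using a A(2) by auto
    then obtain n where n: "a = int n" by (rule zero_le_imp_eq_int[THEN exE])
    have "int (n mod k) = int n - int (n div k) * int k"
      by (simp add: of_nat_mod of_nat_div minus_div_mult_eq_mod)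
    then have "int (n mod k) \<in> G" using G_diff[OF _ multiple] a AG n by auto
    then have "n mod k = 0" using least[of "n mod k"] k by (metis mod_less_divisor not_gr_zero not_le)
    then show ?thesis using n by auto
  qed
  moreover have "k \<noteq> 1" using k \<open>1 \<notin> G\<close> by auto
  then have "2 \<le> k" using k by simp
  ultimately show ?thesis by blast
qed

lemma eq_of_consecutive_powers_eq:
  fixes a b :: "'a::field"
  assumes "a ^ n = b ^ n" "a ^ Suc n = b ^ Suc n"
  shows "a = b"
proof (cases "b = 0")
  case True
  then show ?thesis using assms(2) by auto
next
  case False
  then show ?thesis using assms by simp
qed

text \<open>The base \<open>z\<close> is the ratio of consecutive values, or 0 if some value vanishes, because then all do.\<close>

lemma multiplicative_eventually_power:
  fixes h :: "nat \<Rightarrow> complex"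
  assumes N: "1 \<le> N"
    and mult: "\<And>m n. N \<le> m \<Longrightarrow> N \<le> n \<Longrightarrow> h (m + n) = h m * h n"
    and bounded: "\<And>n. N \<le> n \<Longrightarrow> cmod (h n) \<le> 1"
  shows "\<exists>z. cmod z \<le> 1 \<and> (\<forall>n\<ge>N. h n = z ^ n)"
proof (cases "\<exists>n\<ge>N. h n = 0")
  case True
  then obtain n where n: "N \<le> n" "h n = 0" by blast
  have power: "h (Suc k * m) = h m ^ Suc k" if m: "N \<le> m" for k m
  proof (induction k)
    case (Suc k)
    have "N \<le> Suc k * m" using m by (simp add: trans_le_add1)
    then show ?case using mult[OF m, of "Suc k * m"] Suc by simp
  qed simp
  have "h m = 0" if m: "N \<le> m" for m
  proof -
    obtain k where k: "n = Suc k" using n N by (cases n) auto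
    obtain j where j: "m = Suc j" using m N by (cases m) auto
    have "h m ^ Suc k = h (Suc k * m)" using power[OF m] by simp
    also have "Suc k * m = Suc j * n" by (simp add: k j)
    also have "h (Suc j * n) = 0" using power[OF n(1)] n(2) by simp
    finally show ?thesis by auto
  qed
  then show ?thesis using N by (intro exI[of _ 0]) auto
next
  case False
  then have nz: "h n \<noteq> 0" if "N \<le> n" for n using that by blast
  define z where "z = h (Suc N) / h N"
  have step: "h (Suc n) = z * h n" if n: "N \<le> n" for n
  proof -
    have "h (Suc n) * h N = h (Suc N) * h n"
      using mult[of "Suc n" N] mult[of "Suc N" n] n by (simp add: add.commute)
    then show ?thesis using nz[of N] by (simp add: z_def field_simps)
  qed
  have shift: "h (n + k) = z ^ k * h n" if n: "N \<le> n" for n k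
    by (induction k) (use n in \<open>auto simp: step algebra_simps\<close>)
  have h: "h n = z ^ n" if n: "N \<le> n" for n
    using mult[OF n n] shift[OF n, of n] nz[OF n] by simp
  have "cmod z ^ N \<le> 1" using bounded[of N] h[of N] by (simp add: norm_power)
  then have "cmod z \<le> 1" using N by (simp add: power_le_one_iff)
  with h show ?thesis by blast
qed

context
  fixes S :: "(int ^ 'd) set"
  assumes cone: "positive_cone S" and orthant: "S \<subseteq> nonneg_orthant"
begin

lemma axis_part_nonneg: "axis_part S i \<subseteq> {0..}"
  by (auto simp: axis_part_def)

lemma axis_part_submonoid: "add_submonoid (axis_part S i)"
  using add_submonoid_zero[OF cone_submonoid[OF cone orthant]]
    add_submonoid_add[OF cone_submonoid[OF cone orthant]]
  by (auto simp: add_submonoid_def axis_part_def axis_multiple_add)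

lemma axis_condition_iff:
  "(\<forall>i. positive_cone (axis_part S i) \<and> axis_part S i \<noteq> {0}) \<longleftrightarrow>
    (\<exists>N\<ge>1. \<forall>n\<ge>N. \<forall>i. int n *s axis i 1 \<in> S)"
proof -
  have "(\<forall>i. positive_cone (axis_part S i) \<and> axis_part S i \<noteq> {0}) \<longleftrightarrow>
      (\<forall>i. \<forall>\<^sub>F n in sequentially. int n \<in> axis_part S i)"
    using positive_cone_int_iff_eventually[OF axis_part_submonoid axis_part_nonneg] by blast
  also have "\<dots> \<longleftrightarrow> (\<forall>\<^sub>F n in sequentially. \<forall>i. int n \<in> axis_part S i)"
    using eventually_all_finite[of "\<lambda>n i. int n \<in> axis_part S i"] by (auto elim: eventually_mono)
  also have "\<dots> \<longleftrightarrow> (\<exists>N\<ge>1. \<forall>n\<ge>N. \<forall>i. int n *s axis i 1 \<in> S)"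
  proof
    assume "\<forall>\<^sub>F n in sequentially. \<forall>i. int n \<in> axis_part S i"
    then obtain M where "\<forall>n\<ge>M. \<forall>i. int n \<in> axis_part S i" by (auto simp: eventually_sequentially)
    then show "\<exists>N\<ge>1. \<forall>n\<ge>N. \<forall>i. int n *s axis i 1 \<in> S"
      by (intro exI[of _ "max 1 M"]) (auto simp: axis_part_def)
  qed (auto simp: eventually_sequentially axis_part_def)
  finally show ?thesis .
qed

text \<open>A coordinate of \<open>n v\<close> is either 0 or at least \<open>n\<close>, hence large enough.\<close>

lemma coordinate_multiple_mem:
  assumes N: "\<And>n i. N \<le> n \<Longrightarrow> int n *s axis i 1 \<in> S" and v: "v \<in> nonneg_orthant" and n: "N \<le> n"
  shows "(int n * v $ i) *s axis i 1 \<in> S"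
proof (cases "v $ i = 0")
  case True
  then show ?thesis using add_submonoid_zero[OF cone_submonoid[OF cone orthant]] by (simp add: vec_eq_iff)
next
  case False
  moreover have "0 \<le> v $ i" using v by (simp add: nonneg_orthant_def)
  ultimately have "1 \<le> v $ i" by linarith
  then have "int n * 1 \<le> int n * v $ i" by (intro mult_left_mono) auto
  with n N[of "nat (int n * v $ i)" i] show ?thesis by simp
qed

lemma seminormalization_eq_orthant_iff:
  "seminormalization S = nonneg_orthant \<longleftrightarrow>
    (\<forall>i. positive_cone (axis_part S i) \<and> axis_part S i \<noteq> {0})"
proof
  assume sn: "seminormalization S = nonneg_orthant"
  have "axis i 1 \<in> seminormalization S" for i :: 'd
    unfolding sn by (simp add: nonneg_orthant_def axis_def)
  then have "\<forall>\<^sub>F n in sequentially. int n *s axis i 1 \<in> S" for i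
    by (simp only: seminormalization_iff)
  then have "\<forall>\<^sub>F n in sequentially. int n \<in> axis_part S i" for i
    by (simp add: axis_part_def)
  then show "\<forall>i. positive_cone (axis_part S i) \<and> axis_part S i \<noteq> {0}"
    using positive_cone_int_iff_eventually[OF axis_part_submonoid axis_part_nonneg] by blast
next
  assume "\<forall>i. positive_cone (axis_part S i) \<and> axis_part S i \<noteq> {0}"
  then obtain N where N: "\<And>n i. N \<le> n \<Longrightarrow> int n *s axis i 1 \<in> S"
    unfolding axis_condition_iff by blast
  have "g \<in> nonneg_orthant" if g: "g \<in> seminormalization S" for g
  proof -
    obtain M where M: "\<forall>n\<ge>M. int n *s g \<in> S"
      using g by (auto simp: seminormalization_iff eventually_sequentially)
    have "int (Suc M) *s g \<in> nonneg_orthant" using M orthant by (meson le_SucI order_refl subsetD)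
    then have "0 \<le> int (Suc M) * g $ i" for i
      by (simp only: nonneg_orthant_def mem_Collect_eq vector_smult_component)
    then show ?thesis by (auto simp: nonneg_orthant_def zero_le_mult_iff)
  qed
  moreover have "v \<in> seminormalization S" if v: "v \<in> nonneg_orthant" for v
  proof -
    have "int n *s v \<in> S" if n: "N \<le> n" for n
    proof -
      have "(\<Sum>i\<in>UNIV. (int n * v $ i) *s axis i 1) \<in> S"
        by (intro add_submonoid_sum cone_submonoid[OF cone orthant] coordinate_multiple_mem[OF N v n])
      then show ?thesis using orthant_eq_sum_axes[of "int n *s v"] by simp
    qed
    then show ?thesis by (auto simp: seminormalization_iff eventually_sequentially)
  qed
  ultimately show "seminormalization S = nonneg_orthant" by blast
qed

lemma monomial_value_axis_multiple: "monomial_value \<zeta> (int n *s axis i 1) = (\<zeta> $ i) ^ n"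
proof -
  have "monomial_value \<zeta> (int n *s axis i 1) = (\<Prod>j\<in>UNIV. if j = i then (\<zeta> $ j) ^ n else 1)"
    unfolding monomial_value_def axis_multiple_nth by (intro prod.cong) auto
  then show ?thesis by simp
qed

text \<open>Necessity is by contraposition. If the \<open>i\<close>-th axis part consists of multiples of \<open>k \<ge> 2\<close>, then the
  points \<open>\<omega> e\<^sub>i\<close> and \<open>e\<^sub>i\<close>, with \<open>\<omega>\<close> a nontrivial \<open>k\<close>-th root of unity, give the same character: a
  monomial \<open>z\<^sup>s\<close> not vanishing at them has its exponent \<open>s\<close> on the axis, where \<open>\<omega>\<close> raised to a
  multiple of \<open>k\<close> is 1.\<close>

lemma inj_iota_star_iff:
  "inj_on (iota_star S) closed_polydisc \<longleftrightarrow>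
    (\<forall>i. positive_cone (axis_part S i) \<and> axis_part S i \<noteq> {0})"
proof
  assume "\<forall>i. positive_cone (axis_part S i) \<and> axis_part S i \<noteq> {0}"
  then obtain N where N: "\<And>n i. N \<le> n \<Longrightarrow> int n *s axis i 1 \<in> S"
    unfolding axis_condition_iff by blast
  show "inj_on (iota_star S) closed_polydisc"
  proof (rule inj_onI)
    fix \<zeta> \<eta> assume "\<zeta> \<in> closed_polydisc" "\<eta> \<in> closed_polydisc" "iota_star S \<zeta> = iota_star S \<eta>"
    then have eq: "monomial_value \<zeta> s = monomial_value \<eta> s" if "s \<in> S" for s
      using that iota_star_eq_iff[OF cone orthant] by blast
    have "\<zeta> $ i = \<eta> $ i" for i
    proof (rule eq_of_consecutive_powers_eq)
      show "\<zeta> $ i ^ N = \<eta> $ i ^ N"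
        using eq[OF N[of N i]] by (simp only: monomial_value_axis_multiple order_refl)
      show "\<zeta> $ i ^ Suc N = \<eta> $ i ^ Suc N"
        using eq[OF N[OF le_SucI[OF order_refl]]] by (simp only: monomial_value_axis_multiple)
    qed
    then show "\<zeta> = \<eta>" by (simp add: vec_eq_iff)
  qed
next
  assume inj: "inj_on (iota_star S) closed_polydisc"
  show "\<forall>i. positive_cone (axis_part S i) \<and> axis_part S i \<noteq> {0}"
  proof (rule allI, rule ccontr)
    fix i assume "\<not> (positive_cone (axis_part S i) \<and> axis_part S i \<noteq> {0})"
    from common_divisor_of_not_cone[OF axis_part_submonoid axis_part_nonneg this]
    obtain k :: nat where k: "2 \<le> k" and dvd: "\<And>a. a \<in> axis_part S i \<Longrightarrow> int k dvd a"
      by blast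
    have "card {z::complex. z ^ k = 1} = k" using k by (intro card_roots_unity_eq) simp
    have "\<not> {z::complex. z ^ k = 1} \<subseteq> {1}"
    proof
      assume "{z::complex. z ^ k = 1} \<subseteq> {1}"
      from card_mono[OF _ this] have "card {z::complex. z ^ k = 1} \<le> 1" by simp
      with \<open>card {z::complex. z ^ k = 1} = k\<close> k show False by linarith
    qed
    then obtain \<omega> :: complex where \<omega>: "\<omega> ^ k = 1" "\<omega> \<noteq> 1" by blast
    have norm_\<omega>: "cmod \<omega> = 1"
      using power_eq_1_iff[OF \<omega>(1)] k by simp
    have "monomial_value (axis i \<omega>) s = monomial_value (axis i 1) s" if s: "s \<in> S" for s
    proof (cases "\<exists>j. j \<noteq> i \<and> 0 < s $ j")
      case True
      then have "monomial_value (axis i c) s = 0" for c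
        by (auto simp: monomial_value_def axis_def)
      then show ?thesis by simp
    next
      case False
      have nonneg: "0 \<le> s $ j" for j using s orthant by (auto simp: nonneg_orthant_def)
      with False have zero: "s $ j = 0" if "j \<noteq> i" for j using that by (metis le_less)
      then have s_eq: "s = s $ i *s axis i 1" by (simp add: vec_eq_iff axis_def)
      then have "s $ i \<in> axis_part S i" using s nonneg by (simp add: axis_part_def)
      then obtain m where m: "s $ i = int k * m" using dvd by (auto elim: dvdE)
      have "\<omega> ^ nat (s $ i) = 1" using \<omega>(1) by (simp add: m nat_mult_distrib power_mult)
      then show ?thesis
        using monomial_value_axis_multiple[of _ "nat (s $ i)" i] nonneg[of i] s_eq
        by (simp add: axis_def)
    qed
    moreover have "axis i \<omega> \<in> closed_polydisc" "axis i 1 \<in> closed_polydisc"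
      using norm_\<omega> by (auto simp: closed_polydisc_def axis_def)
    ultimately have "iota_star S (axis i \<omega>) = iota_star S (axis i 1)"
      by (simp add: iota_star_eq_iff[OF cone orthant])
    then have "axis i \<omega> = axis i (1::complex)"
      using inj \<open>axis i \<omega> \<in> closed_polydisc\<close> \<open>axis i 1 \<in> closed_polydisc\<close> by (meson inj_onD)
    then have "(axis i \<omega>) $ i = (axis i (1::complex)) $ i" by simp
    then show False using \<omega>(2) by (simp add: axis_def)
  qed
qed

text \<open>The numbers \<open>z i\<close> read off along the axes satisfy \<open>\<phi>(V\<^sub>s)\<^sup>n = (\<zeta>\<^sup>s)\<^sup>n\<close> for all large \<open>n\<close>, because \<open>n s\<close>
  is a sum of far axis points; two consecutive exponents remove the power.\<close>

lemma iota_star_surj: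
  assumes axes: "\<forall>i. positive_cone (axis_part S i) \<and> axis_part S i \<noteq> {0}"
  shows "iota_star S ` closed_polydisc = character_space S"
proof (intro equalityI subsetI)
  fix \<phi> assume "\<phi> \<in> iota_star S ` closed_polydisc"
  then show "\<phi> \<in> character_space S" using iota_star_character[OF cone orthant] by blast
next
  fix \<phi> assume \<phi>: "\<phi> \<in> character_space S"
  note S = cone_submonoid[OF cone orthant]
  define \<kappa> where "\<kappa> = (\<lambda>s. \<phi> (fock S s))"
  have \<kappa>_add: "\<kappa> (s + t) = \<kappa> s * \<kappa> t" if "s \<in> S" "t \<in> S" for s t
    unfolding \<kappa>_def by (rule character_fock_add[OF S \<phi> that])
  have \<kappa>0: "\<kappa> 0 = 1" unfolding \<kappa>_def by (rule character_fock_zero[OF S \<phi>])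
  have \<kappa>_le: "cmod (\<kappa> s) \<le> 1" if "s \<in> S" for s
    unfolding \<kappa>_def by (rule character_fock_le[OF S \<phi> that])
  have \<kappa>_sum: "\<kappa> (sum f I) = (\<Prod>i\<in>I. \<kappa> (f i))" if "\<And>i. i \<in> I \<Longrightarrow> f i \<in> S" "finite I" for f and I :: "'d set"
    using that(2,1) by (induction I) (auto simp: \<kappa>0 \<kappa>_add add_submonoid_sum[OF S])
  have multiple: "int n *s s \<in> S \<and> \<kappa> (int n *s s) = \<kappa> s ^ n" if s: "s \<in> S" for n s
  proof (induction n)
    case 0
    then show ?case using add_submonoid_zero[OF S] by (simp add: \<kappa>0)
  next
    case (Suc n)
    have "int (Suc n) *s s = s + int n *s s" by (simp add: vec_eq_iff algebra_simps)
    then show ?case using Suc s by (simp add: \<kappa>_add add_submonoid_add[OF S])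
  qed
  obtain N where N1: "1 \<le> N" and N: "\<And>n i. N \<le> n \<Longrightarrow> int n *s axis i 1 \<in> S"
    using axes unfolding axis_condition_iff by blast
  have "\<exists>z. cmod z \<le> 1 \<and> (\<forall>n\<ge>N. \<kappa> (int n *s axis i 1) = z ^ n)" for i
  proof (rule multiplicative_eventually_power[OF N1])
    fix m n assume "N \<le> m" "N \<le> n"
    then show "\<kappa> (int (m + n) *s axis i 1) = \<kappa> (int m *s axis i 1) * \<kappa> (int n *s axis i 1)"
      by (simp add: axis_multiple_add \<kappa>_add N)
  qed (simp add: \<kappa>_le N)
  then obtain z where z_le: "\<And>i. cmod (z i) \<le> 1" and z: "\<And>i n. N \<le> n \<Longrightarrow> \<kappa> (int n *s axis i 1) = z i ^ n"
    by metis
  define \<zeta> where "\<zeta> = (vec_lambda z :: complex ^ 'd)"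
  have \<zeta>: "\<zeta> \<in> closed_polydisc" using z_le by (simp add: \<zeta>_def closed_polydisc_def)
  have "\<kappa> s = monomial_value \<zeta> s" if s: "s \<in> S" for s
  proof -
    have nonneg: "0 \<le> s $ i" for i using s orthant by (auto simp: nonneg_orthant_def)
    have sO: "s \<in> nonneg_orthant" using s orthant by blast
    have power: "\<kappa> s ^ n = monomial_value \<zeta> s ^ n" if n: "N \<le> n" for n
    proof -
      have coord: "\<kappa> ((int n * s $ i) *s axis i 1) = (z i ^ nat (s $ i)) ^ n" for i
      proof (cases "s $ i = 0")
        case True
        then show ?thesis by (simp add: \<kappa>0)
      next
        case False
        then have "1 \<le> nat (s $ i)" using nonneg[of i] by simp
        then have "n \<le> n * nat (s $ i)" by simp
        with n have "N \<le> n * nat (s $ i)" by (rule le_trans)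
        from z[OF this, of i] have "\<kappa> (int (n * nat (s $ i)) *s axis i 1) = z i ^ (nat (s $ i) * n)"
          by (simp only: mult.commute)
        then show ?thesis using nonneg[of i] by (simp add: power_mult)
      qed
      have "\<kappa> s ^ n = \<kappa> (int n *s s)" using multiple[OF s] by simp
      also have "int n *s s = (\<Sum>i\<in>UNIV. (int n * s $ i) *s axis i 1)"
        using orthant_eq_sum_axes[of "int n *s s"] by simp
      also have "\<kappa> \<dots> = (\<Prod>i\<in>UNIV. \<kappa> ((int n * s $ i) *s axis i 1))"
        by (intro \<kappa>_sum coordinate_multiple_mem[OF N sO n]) auto
      also have "\<dots> = monomial_value \<zeta> s ^ n"
        by (simp add: coord monomial_value_def \<zeta>_def prod_power_distrib)
      finally show ?thesis .
    qed
    show ?thesis by (rule eq_of_consecutive_powers_eq[OF power[OF order_refl] power[OF le_SucI[OF order_refl]]])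
  qed
  then have "iota_star S \<zeta> = \<phi>"
    using iota_star_fock[OF cone orthant \<zeta>]
    by (intro character_eqI[OF S iota_star_character[OF cone orthant \<zeta>] \<phi>]) (simp add: \<kappa>_def)
  with \<zeta> show "\<phi> \<in> iota_star S ` closed_polydisc" by blast
qed

end

theorem proposition3p4:
  fixes S :: "(int ^ 'd) set"
  assumes "positive_cone S" and "S \<subseteq> nonneg_orthant"
  shows "continuous_map (top_of_set closed_polydisc) (character_topology S) (iota_star S)
    \<and> (seminormalization S = nonneg_orthant
         \<longleftrightarrow> (\<forall>i. positive_cone (axis_part S i) \<and> axis_part S i \<noteq> {0}))
    \<and> ((\<forall>i. positive_cone (axis_part S i) \<and> axis_part S i \<noteq> {0})
         \<longleftrightarrow> inj_on (iota_star S) closed_polydisc)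
    \<and> (inj_on (iota_star S) closed_polydisc
         \<longrightarrow> homeomorphic_map (top_of_set closed_polydisc) (character_topology S) (iota_star S))"
proof (intro conjI impI)
  show cont: "continuous_map (top_of_set closed_polydisc) (character_topology S) (iota_star S)"
    by (rule continuous_iota_star[OF assms])
  show "seminormalization S = nonneg_orthant
      \<longleftrightarrow> (\<forall>i. positive_cone (axis_part S i) \<and> axis_part S i \<noteq> {0})"
    by (rule seminormalization_eq_orthant_iff[OF assms])
  show "(\<forall>i. positive_cone (axis_part S i) \<and> axis_part S i \<noteq> {0})
      \<longleftrightarrow> inj_on (iota_star S) closed_polydisc"
    using inj_iota_star_iff[OF assms] by blast
  assume inj: "inj_on (iota_star S) closed_polydisc"
  show "homeomorphic_map (top_of_set closed_polydisc) (character_topology S) (iota_star S)"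
  proof (rule continuous_imp_homeomorphic_map[OF cont])
    show "compact_space (top_of_set (closed_polydisc :: (complex ^ 'd) set))"
      by (intro compact_space_subtopology) (simp add: compact_closed_polydisc)
    show "iota_star S ` topspace (top_of_set closed_polydisc) = topspace (character_topology S)"
      using iota_star_surj[OF assms] inj inj_iota_star_iff[OF assms]
      by (simp add: topspace_character_topology)
  qed (use inj Hausdorff_character_topology[OF assms] in auto)
qed

end
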